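(* (A) For every primitive set $A$: $0 \le \underline{\eta}(A) \le \overline{\eta}(A) \le 1$. (B) For every $k \ge 0$, $\eta(\mathbb{P}_k) = 1$. (C) There exists a primitive set $A$ with $\underline{\eta}(A) = 0$ and $\overline{\eta}(A) = 1$. (D) Let $k \ge 0$ and $A \subseteq \mathbb{P}_k$. If \[ \lim_{s \to 1^+}\frac{\sum_{a \in A} a^{-s}}{\sum_{m \in \mathbb{P}_k} m^{-s}} = c, \] then $A$ has primitive density $\eta(A) = c$. (E) Let $B \subseteq \{2,3,\ldots\}$ and $n \in \mathbb{N}$. If $\overline{\eta}(B) > n - 1$, then there exist pairwise distinct elements $b_{j,i} \in B$ ($j \in \mathbb{N}$, $1 \le i \le n$) such that $b_{j,i} \mid b_{j,i+1}$ for all $j \in \mathbb{N}$ and $1 \le i \le n-1$. (F) There exists a set $B \subseteq \{2,3,\ldots\}$ with $\eta(B) = \infty$ that contains no infinite sequence $b_1, b_2, \ldots$ with $b_i \mid b_{i+1}$ for all $i$.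
   Context: A set $A \subseteq \mathbb{N}$ is primitive if for $a_1, a_2 \in A$, $a_1 \mid a_2$ implies $a_1 = a_2$. $\Omega(n)$ is the number of prime factors of $n$ counted with multiplicity, and $\mathbb{P}_k = \{n : \Omega(n) = k\}$ (so $\mathbb{P}_0 = \{1\}$). For $z > 0$ and $A \subseteq \{2,3,\ldots\}$ let $f_z(A) = \sum_{a \in A}\frac{z^{\Omega(a)}}{a(\log a)^z} \in [0,\infty]$, and define $\overline{\eta}(A) = \limsup_{z\to 0^+} f_z(A)$ and $\underline{\eta}(A) = \liminf_{z \to 0^+} f_z(A)$. If these coincide, their common value is the primitive density $\eta(A)$. By convention $\eta(\{1\}) = 1$ (and $\overline{\eta}(\{1\}) = \underline{\eta}(\{1\}) = 1$).
   Formalization: In (F) the excluded infinite sequences b_1, b_2, ... with b_i | b_{i+1} are required to have pairwise distinct terms, since read literally a constant sequence b, b, b, ... would refute the claim for every nonempty B. *)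

theory Defs
  imports
    "HOL-Analysis.Analysis"
    "HOL-Computational_Algebra.Primes"
begin

definition primitive_set :: "nat set \<Rightarrow> bool" where
  "primitive_set A \<longleftrightarrow>
     A \<subseteq> {1..} \<and> (\<forall>a\<^sub>1\<in>A. \<forall>a\<^sub>2\<in>A. a\<^sub>1 dvd a\<^sub>2 \<longrightarrow> a\<^sub>1 = a\<^sub>2)"

definition prime_Omega :: "nat \<Rightarrow> nat" where
  "prime_Omega n = size (prime_factorization n)"

(* The library sets prime_factorization 0 = {#}, so 0 has to be excluded by hand. *)
definition almost_primes :: "nat \<Rightarrow> nat set" where
  "almost_primes k = {n. n \<ge> 1 \<and> prime_Omega n = k}"

(* The intended domain is z > 0 and A \<subseteq> {2..}; infsum in ennreal always exists. *)
definition f_sum :: "real \<Rightarrow> nat set \<Rightarrow> ennreal" where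
  "f_sum z A = (\<Sum>\<^sub>\<infinity>a\<in>A. ennreal (z ^ prime_Omega a / (real a * ln (real a) powr z)))"

(* At a = 1 the summand of f_sum is 1 / 0 = 0 in HOL;
   the set {1} has density 1 by convention. *)
definition upper_eta :: "nat set \<Rightarrow> ennreal" where
  "upper_eta A = (if A = {1} then 1 else Limsup (at_right 0) (\<lambda>z. f_sum z A))"

definition lower_eta :: "nat set \<Rightarrow> ennreal" where
  "lower_eta A = (if A = {1} then 1 else Liminf (at_right 0) (\<lambda>z. f_sum z A))"

definition has_primitive_density :: "nat set \<Rightarrow> ennreal \<Rightarrow> bool" where
  "has_primitive_density A d \<longleftrightarrow> lower_eta A = d \<and> upper_eta A = d"

end

theory Submission
  imports Defs
begin

text \<open>The upper bound for primitive sets is Erdos' disjointness argument for the weight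
  \<open>z ^ \<Omega>(n) / n\<close>: it gives \<open>\<Sum>a z ^ \<Omega>(a) / a * \<Prod>p<P(a) (1 - z / p) \<le> 1\<close>, where \<open>P(a)\<close> is the
  largest prime factor, and by the upper bound in Mertens' theorem the product is at least
  \<open>exp (- 18 z) / (ln a) powr z\<close>. Hence \<open>f_sum z A \<le> exp (18 z)\<close>, which tends to \<open>1\<close>. Peeling off the minimal
  elements of a set \<open>n - 1\<close> times then yields divisibility chains of length \<open>n\<close>.

  The densities of subsets of the almost primes come from
  \<open>\<Gamma>(z) / (ln a) powr z = \<integral> t powr (z - 1) * a powr -t dt\<close>, which expresses \<open>f_sum z A\<close> through the Dirichlet series
  of \<open>A\<close> at \<open>1 + t\<close>, and \<open>\<integral> t powr (z - 1) * (- ln t) ^ k dt = k! / z ^ (k + 1)\<close> over \<open>(0, 1)\<close>: a Dirichlet series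
  asymptotic to \<open>c * (- ln t) ^ k / k!\<close> produces the density \<open>c\<close>. For numbers with \<open>k\<close> prime factors this asymptotics
  holds with \<open>c = 1\<close>, even if all prime factors have to exceed a given bound, which allows infinitely
  many disjoint pieces of density \<open>1\<close> in a set without infinite chains.\<close>

section \<open>Euler products\<close>

text \<open>What makes crude estimates sufficient is that every constant enters to the power z: a
  bounded error in Mertens' theorem turns into a factor \<open>exp (C * z)\<close>, which disappears
  as z \<rightarrow> 0. Bounds on the prime sum that are exact only up to O(1), read off from zeta
  near its pole, are therefore enough.

  The sum of z^Omega(n) / n over all n diverges for z > 0, so disjointness of the sets of multiples
  says nothing by itself. It is exploited relative to the finite Euler product over the primes up to
  the largest element of a finite primitive set, where the factors at large primes cancel.

  For subsets of the almost primes the passage is Abelian only: an asymptotic of the Dirichlet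
  series is integrated, and no counting function of the set is ever estimated.

  For the oscillating set, sets of primes suffice, since they are all primitive. The primes up to a
  fixed N carry mass tending to 0 while all primes together carry mass tending to 1, so the mass
  escapes to infinity and one can decide, range by range, whether to keep it.\<close>

lemma summable_on_ennreal_valued [simp]: "(f :: 'a \<Rightarrow> ennreal) summable_on A"
  by (rule nonneg_summable_on_complete) simp

lemma infsum_ennreal_eq_nn_integral:
  fixes f :: "nat \<Rightarrow> ennreal"
  shows "infsum f A = (\<integral>\<^sup>+x. f x \<partial>count_space A)"
proof -
  have "infsum f A = infsum (\<lambda>x. f x * indicator A x) UNIV"
    by (rule infsum_cong_neutral) (auto simp: indicator_def)
  also have "\<dots> = suminf (\<lambda>x. f x * indicator A x)"
    by (rule sums_unique, rule has_sum_imp_sums, rule has_sum_infsum) simp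
  also have "\<dots> = (\<integral>\<^sup>+x. f x * indicator A x \<partial>count_space UNIV)"
    by (simp add: nn_integral_count_space_nat)
  also have "\<dots> = (\<integral>\<^sup>+x. f x \<partial>count_space A)"
    by (simp add: nn_integral_count_space_indicator)
  finally show ?thesis .
qed

lemma infsum_swap_ennreal:
  fixes f :: "nat \<Rightarrow> nat \<Rightarrow> ennreal"
  shows "(\<Sum>\<^sub>\<infinity>x\<in>A. \<Sum>\<^sub>\<infinity>y\<in>B. f x y) = (\<Sum>\<^sub>\<infinity>y\<in>B. \<Sum>\<^sub>\<infinity>x\<in>A. f x y)"
  unfolding infsum_ennreal_eq_nn_integral
  by (rule nn_integral_count_space_nn_integral) auto

lemma infsum_cmult_ennreal:
  fixes f :: "nat \<Rightarrow> ennreal"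
  shows "(\<Sum>\<^sub>\<infinity>x\<in>A. c * f x) = c * infsum f A"
  unfolding infsum_ennreal_eq_nn_integral by (rule nn_integral_cmult) simp

lemma infsum_add_ennreal:
  fixes f :: "nat \<Rightarrow> ennreal"
  shows "(\<Sum>\<^sub>\<infinity>x\<in>A. f x + g x) = infsum f A + infsum g A"
  unfolding infsum_ennreal_eq_nn_integral by (rule nn_integral_add) simp_all

lemma infsum_mono_ennreal:
  fixes f g :: "nat \<Rightarrow> ennreal"
  assumes "A \<subseteq> B" "\<And>x. x \<in> A \<Longrightarrow> f x \<le> g x"
  shows "infsum f A \<le> infsum g B"
  by (rule infsum_mono_neutral) (use assms in auto)

lemma ennreal_infsum:
  fixes f :: "nat \<Rightarrow> real"
  assumes "f summable_on A" "\<And>x. x \<in> A \<Longrightarrow> 0 \<le> f x"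
  shows "ennreal (infsum f A) = (\<Sum>\<^sub>\<infinity>x\<in>A. ennreal (f x))"
  by (subst infsum_nonneg_is_SUPREMUM_ennreal[OF assms])
     (auto simp: nonneg_infsum_complete intro!: SUP_cong sum_ennreal[symmetric] dest: assms(2))

section \<open>Smooth numbers and Euler products over finitely many primes\<close>

definition smooth_numbers :: "nat set \<Rightarrow> nat set" where
  "smooth_numbers Q = {n. n \<ge> 1 \<and> prime_factors n \<subseteq> Q}"

lemma smooth_numbers_empty: "smooth_numbers {} = {1}"
  by (auto simp: smooth_numbers_def prime_factorization_empty_iff)

text \<open>Unique factorisation, seen from a single prime: the inverse splits off the full power of
  p.\<close>

lemma bij_betw_smooth_numbers_insert:
  assumes "prime p" "p \<notin> Q"
  shows "bij_betw (\<lambda>(i, m). p ^ i * m) (UNIV \<times> smooth_numbers Q) (smooth_numbers (insert p Q))"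
proof (rule bij_betw_byWitness[where f' = "\<lambda>n. (multiplicity p n, n div p ^ multiplicity p n)"], goal_cases)
  case 1
  show ?case
  proof clarify
    fix i m assume m: "m \<in> smooth_numbers Q"
    then have "\<not> p dvd m"
      using assms by (auto simp: smooth_numbers_def prime_factors_dvd)
    moreover have "m > 0" using m by (auto simp: smooth_numbers_def)
    ultimately have "multiplicity p (p ^ i * m) = i"
      using assms by (simp add: multiplicity_prime_elem_times_other prime_elem_multiplicity_mult_distrib not_dvd_imp_multiplicity_0)
    then show "multiplicity p (p ^ i * m) = i \<and> p ^ i * m div p ^ multiplicity p (p ^ i * m) = m"
      using assms by (simp add: prime_gt_0_nat)
  qed
next
  case 2
  show ?case by (auto simp: multiplicity_dvd)
next
  case 3
  show ?case
    using assms prime_gt_0_nat[of p]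
    by (auto simp: smooth_numbers_def prime_factorization_mult prime_factorization_prime_power Suc_le_eq split: if_splits)
next
  case 4
  show ?case
  proof clarsimp
    fix n assume n: "n \<in> smooth_numbers (insert p Q)"
    then have n0: "n \<noteq> 0" by (auto simp: smooth_numbers_def)
    define m where "m = n div p ^ multiplicity p n"
    have nm: "n = p ^ multiplicity p n * m" by (simp add: m_def multiplicity_dvd)
    then have m0: "m \<noteq> 0" using n0 by (metis mult_0_right)
    have "\<not> p dvd m"
      using multiplicity_decompose[of n p] n0 assms unfolding m_def by (metis not_prime_unit)
    moreover have "prime_factors m \<subseteq> prime_factors n"
      using n0 nm by (metis dvd_prime_factors dvd_triv_right)
    ultimately show "n div p ^ multiplicity p n \<in> smooth_numbers Q"
      using n m0 unfolding m_def[symmetric] by (auto simp: smooth_numbers_def)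
  qed
qed

text \<open>Adding a prime multiplies the sum by a geometric series. The general g serves two
  weights, n powr -s and z^Omega(n) / n; for the second the sum over all n diverges, so the prime
  set has to stay finite.\<close>

lemma has_sum_euler_product:
  fixes g :: "nat \<Rightarrow> real"
  assumes "finite Q" "\<And>p. p \<in> Q \<Longrightarrow> prime p"
    and g1: "g 1 = 1" and gm: "\<And>m n. g (m * n) = g m * g n" and g0: "\<And>n. 0 \<le> g n"
    and gp: "\<And>p. p \<in> Q \<Longrightarrow> g p < 1"
  shows "(g has_sum (\<Prod>p\<in>Q. 1 / (1 - g p))) (smooth_numbers Q)"
  using assms(1,2) gp
proof (induction Q)
  case empty
  then show ?case using g1 by (simp add: smooth_numbers_empty has_sum_finite_iff)
next
  case (insert p Q)
  have gpow: "g (p ^ i) = g p ^ i" for i by (induction i) (simp_all add: gm g1[simplified])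
  have IH: "(g has_sum (\<Prod>p\<in>Q. 1 / (1 - g p))) (smooth_numbers Q)" using insert by simp
  let ?f = "\<lambda>(i, m). g (p ^ i * m)"
  have inner: "((\<lambda>m. ?f (i, m)) has_sum (g p ^ i * (\<Prod>p\<in>Q. 1 / (1 - g p)))) (smooth_numbers Q)" for i
    using has_sum_cmult_right[OF IH] by (simp add: gm gpow)
  have "(\<lambda>i. g p ^ i) sums (1 / (1 - g p))"
    using insert.prems g0[of p] by (intro geometric_sums) auto
  then have "((\<lambda>i. g p ^ i) has_sum (1 / (1 - g p))) UNIV"
    using g0 by (intro sums_nonneg_imp_has_sum) auto
  then have outer: "((\<lambda>i. g p ^ i * (\<Prod>p\<in>Q. 1 / (1 - g p))) has_sum (1 / (1 - g p) * (\<Prod>p\<in>Q. 1 / (1 - g p)))) UNIV"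
    by (rule has_sum_cmult_left)
  have "(?f has_sum (1 / (1 - g p) * (\<Prod>p\<in>Q. 1 / (1 - g p)))) (UNIV \<times> smooth_numbers Q)"
    using inner outer
    by (intro has_sum_SigmaI summable_on_SigmaI) (auto simp: g0 intro: has_sum_imp_summable)
  moreover have "bij_betw (\<lambda>(i, m). p ^ i * m) (UNIV \<times> smooth_numbers Q) (smooth_numbers (insert p Q))"
    using insert by (intro bij_betw_smooth_numbers_insert) auto
  ultimately have "(g has_sum (1 / (1 - g p) * (\<Prod>p\<in>Q. 1 / (1 - g p)))) (smooth_numbers (insert p Q))"
    by (subst has_sum_reindex_bij_betw[symmetric]) (auto simp: case_prod_unfold)
  then show ?case using insert by simp
qed

section \<open>The Dirichlet series of the primes near 1\<close>

definition dseries :: "nat set \<Rightarrow> real \<Rightarrow> real" where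
  "dseries A s = (\<Sum>\<^sub>\<infinity>a\<in>A. real a powr (-s))"

lemma summable_on_powr:
  assumes "s > 1"
  shows "(\<lambda>n::nat. real n powr (-s)) summable_on A"
proof -
  have "summable (\<lambda>n. real n powr (-s))"
    using assms by (simp add: summable_real_powr_iff)
  then have "(\<lambda>n::nat. real n powr (-s)) summable_on UNIV"
    by (rule summable_nonneg_imp_summable_on) simp
  then show ?thesis by (rule summable_on_subset_banach) simp
qed

lemma dseries_nonneg: "dseries A s \<ge> 0"
  unfolding dseries_def by (intro infsum_nonneg) simp

lemma dseries_mono: "s > 1 \<Longrightarrow> A \<subseteq> B \<Longrightarrow> dseries A s \<le> dseries B s"
  unfolding dseries_def by (intro infsum_mono2 summable_on_powr) auto

section \<open>Zeta near its pole\<close>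

text \<open>Mean value theorem for x powr -t, whose derivative is monotone. Telescoping these
  differences replaces the comparison of zeta with an integral.\<close>

lemma powr_diff_bounds:
  fixes t :: real
  assumes "n \<ge> 1" "t > 0"
  shows "t * real (Suc n) powr (-1-t) \<le> real n powr -t - real (Suc n) powr -t"
    and "real n powr -t - real (Suc n) powr -t \<le> t * real n powr (-1-t)"
proof -
  have der: "\<And>x. real n \<le> x \<Longrightarrow> x \<le> real (Suc n) \<Longrightarrow>
      ((\<lambda>x. x powr -t) has_real_derivative (-t) * x powr (-t - 1)) (at x)"
    using assms by (auto intro!: derivative_eq_intros)
  obtain z where z: "real n < z" "z < real (Suc n)"
    and eq: "real (Suc n) powr -t - real n powr -t = (real (Suc n) - real n) * ((-t) * z powr (-t - 1))"
    using MVT2[of "real n" "real (Suc n)" "\<lambda>x. x powr -t" "\<lambda>x. (-t) * x powr (-t - 1)"] der by auto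
  have e: "-t - 1 = -1 - t" by simp
  have "real (Suc n) powr (-1-t) \<le> z powr (-1-t)" "z powr (-1-t) \<le> real n powr (-1-t)"
    using z assms by (auto intro!: powr_mono2')
  then have "t * real (Suc n) powr (-1-t) \<le> t * z powr (-1-t)" "t * z powr (-1-t) \<le> t * real n powr (-1-t)"
    using assms by (auto intro!: mult_left_mono simp del: of_nat_Suc)
  with eq show "t * real (Suc n) powr (-1-t) \<le> real n powr -t - real (Suc n) powr -t"
    and "real n powr -t - real (Suc n) powr -t \<le> t * real n powr (-1-t)"
    by (simp_all add: e)
qed

lemma zeta_bounds:
  fixes t :: real
  assumes "t > 0"
  shows "1 / t \<le> dseries {1..} (1 + t)" "dseries {1..} (1 + t) \<le> 1 + 1 / t"
proof -
  have "(\<lambda>n. real n powr -t) \<longlonglongrightarrow> 0"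
    by (rule tendsto_neg_powr[OF _ filterlim_real_sequentially]) (use assms in auto)
  then have "(\<lambda>n. real (Suc n) powr -t) \<longlonglongrightarrow> 0"
    by (rule LIMSEQ_Suc)
  from telescope_sums'[OF this] have "(\<lambda>n. real (Suc n) powr -t - real (Suc (Suc n)) powr -t) sums 1"
    by simp
  then have T: "((\<lambda>n. real (Suc n) powr -t - real (Suc (Suc n)) powr -t) has_sum 1) UNIV"
    using assms by (intro sums_nonneg_imp_has_sum) (auto intro!: powr_mono2')
  have e: "- (1 + t) = -1 - t" by simp
  have z: "((\<lambda>n. real n powr (-1-t)) has_sum (dseries {1..} (1 + t))) {1..}"
    unfolding dseries_def e[symmetric] using assms by (intro has_sum_infsum summable_on_powr) auto
  have z1: "((\<lambda>n. real (Suc n) powr (-1-t)) has_sum (dseries {1..} (1 + t))) UNIV"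
  proof -
    have "bij_betw Suc UNIV {1..}"
      by (rule bij_betw_byWitness[where f' = "\<lambda>n. n - 1"]) auto
    then show ?thesis using z by (subst has_sum_reindex_bij_betw[where g = Suc and B = "{1..}"])
  qed
  \<comment> \<open>The term split off is 1 powr (-1-t) = 1. It is the 1 in the upper bound, since
    the telescoping sum only dominates the terms from n = 2 on.\<close>
  have z2: "((\<lambda>n. real (Suc n) powr (-1-t)) has_sum (dseries {1..} (1 + t) - 1)) {1..}"
  proof -
    have "((\<lambda>n. real (Suc n) powr (-1-t)) has_sum (dseries {1..} (1 + t) - 1)) (UNIV - {0})"
      by (rule has_sum_Diff[OF z1]) (auto simp: has_sum_finite_iff)
    moreover have "UNIV - {0} = {1::nat..}" by auto
    ultimately show ?thesis by simp
  qed
  have z3: "((\<lambda>n. real (Suc (Suc n)) powr (-1-t)) has_sum (dseries {1..} (1 + t) - 1)) UNIV"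
  proof -
    have "bij_betw Suc UNIV {1..}"
      by (rule bij_betw_byWitness[where f' = "\<lambda>n. n - 1"]) auto
    then show ?thesis using z2
      by (subst has_sum_reindex_bij_betw[where g = Suc and B = "{1..}" and f = "\<lambda>n. real (Suc n) powr (-1-t)"])
  qed
  have "1 \<le> t * dseries {1..} (1 + t)"
    by (rule has_sum_mono[OF T has_sum_cmult_right[OF z1]]) (use assms powr_diff_bounds(2) in \<open>simp del: of_nat_Suc\<close>)
  then show "1 / t \<le> dseries {1..} (1 + t)" using assms by (simp add: field_simps)
  have "t * (dseries {1..} (1 + t) - 1) \<le> 1"
    by (rule has_sum_mono[OF has_sum_cmult_right[OF z3] T])
       (use assms powr_diff_bounds(1) in \<open>simp del: of_nat_Suc\<close>)
  then show "dseries {1..} (1 + t) \<le> 1 + 1 / t" using assms by (simp add: field_simps)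
qed

section \<open>The sum over primes near the pole\<close>

lemma prod_inverse_ge_exp_sum:
  fixes x :: "'a \<Rightarrow> real"
  assumes "\<And>p. p \<in> Q \<Longrightarrow> 0 \<le> x p \<and> x p < 1"
  shows "exp (\<Sum>p\<in>Q. x p) \<le> (\<Prod>p\<in>Q. 1 / (1 - x p))"
proof (cases "finite Q")
  case True
  have "exp (x p) \<le> 1 / (1 - x p)" if "p \<in> Q" for p
    using exp_ge_add_one_self[of "- x p"] assms[OF that] by (simp add: exp_minus field_simps)
  then show ?thesis using True by (auto simp: exp_sum intro!: prod_mono)
qed simp

lemma exp_le_one_minus:
  fixes x :: real
  assumes "0 \<le> x" "x \<le> 1/2"
  shows "exp (- x - 2 * x\<^sup>2) \<le> 1 - x"
  using ln_one_minus_pos_lower_bound[OF assms] assms by (subst ln_ge_iff[symmetric]) auto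

lemma prod_inverse_le_exp_sum:
  fixes x :: "'a \<Rightarrow> real"
  assumes "\<And>p. p \<in> Q \<Longrightarrow> 0 \<le> x p \<and> x p \<le> 1/2"
  shows "(\<Prod>p\<in>Q. 1 / (1 - x p)) \<le> exp ((\<Sum>p\<in>Q. x p) + 2 * (\<Sum>p\<in>Q. (x p)\<^sup>2))"
proof (cases "finite Q")
  case True
  have "1 / (1 - x p) \<le> exp (x p + 2 * (x p)\<^sup>2)" if "p \<in> Q" for p
  proof -
    have "1 / (1 - x p) \<le> 1 / exp (- x p - 2 * (x p)\<^sup>2)"
      using exp_le_one_minus[of "x p"] assms[OF that] by (intro divide_left_mono) auto
    also have "\<dots> = exp (x p + 2 * (x p)\<^sup>2)"
      by (simp add: exp_minus[symmetric] divide_inverse)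
    finally show ?thesis .
  qed
  then have "(\<Prod>p\<in>Q. 1 / (1 - x p)) \<le> (\<Prod>p\<in>Q. exp (x p + 2 * (x p)\<^sup>2))"
    using assms by (intro prod_mono) (force intro: divide_nonneg_nonneg)
  also have "\<dots> = exp ((\<Sum>p\<in>Q. x p) + 2 * (\<Sum>p\<in>Q. (x p)\<^sup>2))"
    using True by (simp add: exp_sum[symmetric] sum.distrib sum_distrib_left)
  finally show ?thesis .
qed simp

lemma prime_powr_le_half:
  assumes "prime (p::nat)" "s \<ge> 1"
  shows "real p powr (-s) \<le> 1/2"
proof -
  have "real p powr (-s) \<le> real p powr (-1)"
    using assms prime_ge_2_nat[of p] by (intro powr_mono) auto
  also have "\<dots> \<le> 1/2"
    using prime_ge_2_nat[OF assms(1)] by (simp add: powr_minus_divide divide_simps)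
  finally show ?thesis .
qed

lemma has_sum_smooth_powr:
  assumes "finite Q" "\<And>p. p \<in> Q \<Longrightarrow> prime p" "s > 1"
  shows "((\<lambda>n. real n powr (-s)) has_sum (\<Prod>p\<in>Q. 1 / (1 - real p powr (-s)))) (smooth_numbers Q)"
proof (rule has_sum_euler_product)
  fix p assume "p \<in> Q"
  then show "real p powr (-s) < 1"
    using prime_powr_le_half[of p s] assms by force
qed (use assms in \<open>auto simp: powr_mult\<close>)

lemma prime_dseries_bounds:
  fixes t :: real
  assumes "0 < t" "t \<le> 1"
  shows "dseries {p. prime p} (1 + t) \<le> - ln t + 1"
    and "- ln t - 4 \<le> dseries {p. prime p} (1 + t)"
proof -
  have s: "1 + t > 1" using assms by simp
  let ?x = "\<lambda>p::nat. real p powr (-(1 + t))"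
  have "(\<Sum>p\<in>Q. ?x p) \<le> - ln t + 1" if Q: "finite Q" "Q \<subseteq> {p. prime p}" for Q
  proof -
    have "exp (\<Sum>p\<in>Q. ?x p) \<le> (\<Prod>p\<in>Q. 1 / (1 - ?x p))"
    proof (rule prod_inverse_ge_exp_sum)
      fix p assume "p \<in> Q"
      then show "0 \<le> ?x p \<and> ?x p < 1"
        using prime_powr_le_half[of p "1 + t"] Q assms by (auto intro: le_less_trans)
    qed
    also have "\<dots> = dseries (smooth_numbers Q) (1 + t)"
      unfolding dseries_def using has_sum_smooth_powr[of Q "1+t"] Q s by (auto intro: infsumI[symmetric])
    also have "\<dots> \<le> dseries {1..} (1 + t)"
      using s by (intro dseries_mono) (auto simp: smooth_numbers_def)
    also have "\<dots> \<le> 1 + 1 / t"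
      using zeta_bounds assms by auto
    \<comment> \<open>Here t \<le> 1 enters; then 2 \<le> e produces the additive constant
      1.\<close>
    also have "\<dots> \<le> 2 / t" using assms by (simp add: field_simps)
    also have "\<dots> \<le> exp 1 / t" 
      using assms exp_ge_add_one_self[of 1] by (intro divide_right_mono) auto
    also have "\<dots> = exp (- ln t + 1)" using assms by (simp add: exp_diff)
    finally show ?thesis by simp
  qed
  then show "dseries {p. prime p} (1 + t) \<le> - ln t + 1"
    unfolding dseries_def by (intro infsum_le_finite_sums summable_on_powr s)
  let ?P = "dseries {p. prime p} (1 + t)"
  have "dseries {1..} (1 + t) \<le> exp (?P + 4)"
    unfolding dseries_def
  proof (intro infsum_le_finite_sums summable_on_powr s, fold dseries_def)
    fix F :: "nat set" assume F: "finite F" "F \<subseteq> {1..}"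
    \<comment> \<open>Every element of F is Q-smooth, so a finite Euler product bounds the sum over
      F and no infinite product is needed. The 4 in the exponent is twice the bound 2 for zeta(2),
      coming from the squares.\<close>
    define Q where "Q = (\<Union>n\<in>F. prime_factors n)"
    have Q: "finite Q" "\<And>p. p \<in> Q \<Longrightarrow> prime p" using F by (auto simp: Q_def)
    have "sum ?x F \<le> (\<Prod>p\<in>Q. 1 / (1 - ?x p))"
      by (rule finite_sum_le_has_sum[OF has_sum_smooth_powr])
         (use F Q s in \<open>auto simp: smooth_numbers_def Q_def\<close>)
    also have "\<dots> \<le> exp ((\<Sum>p\<in>Q. ?x p) + 2 * (\<Sum>p\<in>Q. (?x p)\<^sup>2))"
      using Q s prime_powr_le_half[of _ "1+t"] by (intro prod_inverse_le_exp_sum) auto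
    also have "\<dots> \<le> exp (?P + 4)"
    proof -
      have "(\<Sum>p\<in>Q. ?x p) \<le> ?P"
        unfolding dseries_def using Q s by (intro finite_sum_le_infsum summable_on_powr) auto
      moreover have "(\<Sum>p\<in>Q. (?x p)\<^sup>2) \<le> (\<Sum>p\<in>Q. real p powr (-2))"
      proof (rule sum_mono)
        fix p assume "p \<in> Q"
        then have "real p \<ge> 1" using Q prime_ge_1_nat by force
        then show "(?x p)\<^sup>2 \<le> real p powr (-2)"
          using assms by (auto simp: power2_eq_square powr_add[symmetric] intro!: powr_mono)
      qed
      moreover have "(\<Sum>p\<in>Q. real p powr (-2)) \<le> dseries {1..} (1 + 1)"
        unfolding dseries_def using finite_sum_le_infsum[OF summable_on_powr[of 2], of Q "{1..}"] Q(1) Q(2)[THEN prime_ge_1_nat]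
        by auto
      moreover have "dseries {1..} (1 + 1) \<le> 2"
        using zeta_bounds(2)[of 1] by simp
      ultimately show ?thesis by simp
    qed
    finally show "sum ?x F \<le> exp (?P + 4)" .
  qed
  then have "1 / t \<le> exp (?P + 4)" using zeta_bounds(1)[of t] assms by linarith
  then have "ln (1 / t) \<le> ln (exp (?P + 4))" using assms by (intro ln_mono) auto
  then show "- ln t - 4 \<le> ?P" using assms by (simp add: ln_div)
qed

section \<open>The upper bound in Mertens' theorem\<close>

text \<open>Comparing the exponents \<open>1\<close>, \<open>1 + t/2\<close> and \<open>1 + t\<close> at \<open>t = 1 / ln x\<close> avoids Chebyshev-type estimates.\<close>

lemma sum_prime_reciprocals_le:
  fixes x :: real
  assumes "x \<ge> 3" "finite Q" "\<And>p. p \<in> Q \<Longrightarrow> prime p \<and> real p \<le> x"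
  shows "(\<Sum>p\<in>Q. 1 / real p) \<le> ln (ln x) + 14"
proof -
  define t where "t = 1 / ln x"
  have "exp 1 \<le> x" using assms exp_le by linarith
  then have lnx: "ln x \<ge> 1" using assms by (subst ln_ge_iff) auto
  then have t: "0 < t" "t \<le> 1" by (auto simp: t_def)
  let ?P = "\<lambda>t. dseries {p. prime p} (1 + t)"
  \<comment> \<open>With y = p powr (t/2), the values 1/p, p powr -(1 + t/2) and p powr -(1 + t) are
    in the ratio y^2 : y : 1. The coefficients 3 and -2 come from y^2 \<le> 3y - 2, which is (y -
    1)(y - 2) \<le> 0 and holds for 1 \<le> y \<le> 2; the choice of t ensures y \<le> exp (1/2)
    \<le> 2 for all p \<le> x.\<close>
  let ?h = "\<lambda>p::nat. 3 * real p powr (-(1 + t/2)) + (-2) * real p powr (-(1 + t))"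
  have S: "((\<lambda>p. ?h p) has_sum (3 * ?P (t/2) + (-2) * ?P t)) {p. prime p}"
    unfolding dseries_def using t
    by (intro has_sum_add has_sum_cmult_right has_sum_infsum summable_on_powr) auto
  have "(\<Sum>p\<in>Q. 1 / real p) \<le> (\<Sum>p\<in>Q. ?h p)"
  proof (rule sum_mono)
    fix p assume p: "p \<in> Q"
    then have p2: "real p \<ge> 2" "real p \<le> x" using assms prime_ge_2_nat by force+
    define y where "y = real p powr (t/2)"
    have "y \<le> x powr (t/2)" unfolding y_def using p2 t by (intro powr_mono2) auto
    also have "\<dots> = exp (1/2)" using assms lnx by (simp add: powr_def t_def)
    also have "\<dots> \<le> 2" using exp_bound[of "1/2"] by (simp add: power2_eq_square)
    finally have "y \<le> 2" .
    moreover have y1: "y \<ge> 1" unfolding y_def using p2 t by (intro ge_one_powr_ge_zero) auto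
    ultimately have "(y - 1) * (y - 2) \<le> 0" by (intro mult_nonneg_nonpos) auto
    then have "y * y \<le> 3 * y - 2" by (simp add: algebra_simps)
    then have "real p powr (-(1+t)) * (y * y) \<le> real p powr (-(1+t)) * (3 * y - 2)"
      by (intro mult_left_mono) auto
    moreover have "real p powr (-(1+t)) * (y * y) = 1 / real p"
      unfolding y_def using p2 by (simp add: powr_add[symmetric] powr_minus_divide)
    moreover have "real p powr (-(1+t)) * y = real p powr (-(1+t/2))"
      unfolding y_def powr_add[symmetric]
      by (rule arg_cong[where f = "\<lambda>u. real p powr u"]) simp
    ultimately show "1 / real p \<le> ?h p" by (simp add: algebra_simps)
  qed
  also have "\<dots> \<le> 3 * ?P (t/2) + (-2) * ?P t"
  proof (rule finite_sum_le_has_sum[OF S])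
    fix p assume "p \<in> {p. prime p} - Q"
    then have p: "real p \<ge> 1" using prime_ge_1_nat by force
    have "real p powr (-(1 + t)) \<le> real p powr (-(1 + t/2))" using p t by (intro powr_mono) auto
    moreover have "0 \<le> real p powr (-(1 + t/2))" by simp
    ultimately show "0 \<le> ?h p" by linarith
  qed (use assms in auto)
  \<comment> \<open>The coefficients add up to 1, so the logarithms combine to - ln t + 3 * ln 2 =
    ln (ln x) + 3 * ln 2, and the constants to 3 + 8.\<close>
  also have "\<dots> \<le> 3 * (- ln (t/2) + 1) + (-2) * (- ln t - 4)"
    using prime_dseries_bounds(1)[of "t/2"] prime_dseries_bounds(2)[of t] t by (simp add: algebra_simps)
  also have "\<dots> = ln (ln x) + 3 * ln 2 + 11"
    using t lnx by (simp add: ln_div ln_mult t_def)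
  also have "ln 2 \<le> (1::real)" using ln_2_less_1 by simp
  finally show ?thesis by simp
qed

section \<open>Primitive sets\<close>

lemma prime_Omega_mult: "m > 0 \<Longrightarrow> n > 0 \<Longrightarrow> prime_Omega (m * n) = prime_Omega m + prime_Omega n"
  by (simp add: prime_Omega_def prime_factorization_mult)

lemma prime_Omega_prime: "prime p \<Longrightarrow> prime_Omega p = 1"
  by (simp add: prime_Omega_def prime_factorization_prime)

lemma prime_Omega_1 [simp]: "prime_Omega (Suc 0) = 0"
  by (simp add: prime_Omega_def)

section \<open>Common multiples and the largest prime factor\<close>

definition max_prime :: "nat \<Rightarrow> nat" where
  "max_prime n = Max (prime_factors n)"

lemma max_prime:
  assumes "a \<ge> 2"
  shows "max_prime a \<in> prime_factors a" "\<And>p. p \<in> prime_factors a \<Longrightarrow> p \<le> max_prime a"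
proof -
  have "prime_factors a \<noteq> {}" using assms by (auto simp: prime_factorization_empty_iff)
  then show "max_prime a \<in> prime_factors a" "\<And>p. p \<in> prime_factors a \<Longrightarrow> p \<le> max_prime a"
    by (auto simp: max_prime_def)
qed

text \<open>Below \<open>max_prime b\<close> the cofactor m' has no primes, so there b carries the
  full multiplicity of the common multiple. Above \<open>max_prime a\<close> the number a has none.
  As \<open>max_prime a\<close> is at most \<open>max_prime b\<close>, the only prime left is their
  common value, and there the last hypothesis decides.\<close>

lemma dvd_if_max_prime_le:
  assumes "a \<ge> 2" "b \<ge> 2" "m > 0" "m' > 0" "a * m = b * m'"
    and m: "\<And>p. p \<in> prime_factors m \<Longrightarrow> max_prime a \<le> p"
    and m': "\<And>p. p \<in> prime_factors m' \<Longrightarrow> max_prime b \<le> p"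
    and le: "max_prime a \<le> max_prime b"
    and mult: "max_prime a = max_prime b \<Longrightarrow> multiplicity (max_prime a) a \<le> multiplicity (max_prime a) b"
  shows "a dvd b"
proof (rule multiplicity_le_imp_dvd)
  show "a \<noteq> 0" using assms by auto
  fix p :: nat assume p: "prime p"
  have a: "multiplicity p a + multiplicity p m = multiplicity p (a * m)"
    using assms(1-4) p by (simp add: prime_elem_multiplicity_mult_distrib)
  have b: "multiplicity p b + multiplicity p m' = multiplicity p (a * m)"
    unfolding \<open>a * m = b * m'\<close> using assms(1-4) p by (simp add: prime_elem_multiplicity_mult_distrib)
  have "multiplicity p m' = 0" if "p < max_prime b"
    using m'[of p] that p by (force simp: prime_factors_multiplicity)
  then have lt: "multiplicity p a \<le> multiplicity p b" if "p < max_prime b" using a b that by simp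
  have "multiplicity p a = 0" if "p > max_prime a"
    using max_prime(2)[of a p] that p assms by (auto simp: prime_factors_multiplicity)
  then consider "p < max_prime b" | "multiplicity p a = 0" | "p = max_prime a" "max_prime a = max_prime b"
    using le by fastforce
  then show "multiplicity p a \<le> multiplicity p b"
    using lt mult a b by cases auto
qed

text \<open>The pairs (largest prime, its multiplicity) are compared lexicographically; the number
  with the smaller pair divides the other.\<close>

lemma dvd_or_dvd_of_common_multiple:
  assumes "a \<ge> 2" "b \<ge> 2" "m > 0" "m' > 0" "a * m = b * m'"
    and "\<And>p. p \<in> prime_factors m \<Longrightarrow> max_prime a \<le> p"
    and "\<And>p. p \<in> prime_factors m' \<Longrightarrow> max_prime b \<le> p"
  shows "a dvd b \<or> b dvd a"
proof (cases "max_prime a < max_prime b \<or>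
    max_prime a = max_prime b \<and> multiplicity (max_prime a) a \<le> multiplicity (max_prime a) b")
  case True
  then have "a dvd b" using assms by (intro dvd_if_max_prime_le[of a b m m']) auto
  then show ?thesis ..
next
  case False
  then have "b dvd a" using assms by (intro dvd_if_max_prime_le[of b a m' m]) auto
  then show ?thesis ..
qed

text \<open>Erdos' argument: the sets of multiples \<open>a * m\<close>, where all primes of \<open>m\<close> are at least
  the largest prime of \<open>a\<close>, are disjoint for different elements \<open>a\<close> of a primitive set.\<close>

lemma primitive_sum_prod_le_1:
  fixes z :: real
  assumes A: "finite A" "A \<subseteq> {2..}" "primitive_set A" and z: "0 < z" "z \<le> 1"
  shows "(\<Sum>a\<in>A. z ^ prime_Omega a / a * (\<Prod>p | prime p \<and> p < max_prime a. 1 - z / p)) \<le> 1"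
proof -
  define g where "g = (\<lambda>n. z ^ prime_Omega n / real n)"
  have g1: "g 1 = 1" by (simp add: g_def)
  have gm: "g (m * n) = g m * g n" for m n
    by (cases "m = 0 \<or> n = 0") (auto simp: g_def prime_Omega_mult power_add)
  have g0: "0 \<le> g n" for n using z by (simp add: g_def)
  have gp: "g p = z / p" if "prime p" for p using that by (simp add: g_def prime_Omega_prime)
  have gp1: "g p < 1" if "prime p" for p
    using that prime_ge_2_nat[OF that] z by (simp add: gp)
  have cancel: "(1 - g p) * (1 / (1 - g p)) = 1" if "prime p" for p
    using gp1[OF that] by simp
  \<comment> \<open>A common bound for all primes involved. Inserting 2 keeps the maximum meaningful
    for empty A.\<close>
  define N where "N = Max (insert 2 A)"
  have N: "a \<le> N" if "a \<in> A" for a using that A by (simp add: N_def)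
  define Q where "Q = {p. prime p \<and> p \<le> N}"
  define Qa where "Qa = (\<lambda>a. {p. prime p \<and> p \<le> N \<and> max_prime a \<le> p})"
  define E where "E = (\<lambda>a. (\<lambda>m. a * m) ` smooth_numbers (Qa a))"
  have fin: "finite Q" "finite (Qa a)" for a by (auto simp: Q_def Qa_def)
  have sE: "(g has_sum (g a * (\<Prod>p\<in>Qa a. 1 / (1 - g p)))) (E a)" if "a \<in> A" for a
  proof -
    have "inj_on (\<lambda>m. a * m) (smooth_numbers (Qa a))" using that A by (intro inj_onI) auto
    moreover have "(g has_sum (\<Prod>p\<in>Qa a. 1 / (1 - g p))) (smooth_numbers (Qa a))"
      by (rule has_sum_euler_product[OF fin(2) _ g1 gm g0]) (auto simp: Qa_def gp1)
    ultimately show ?thesis unfolding E_def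
      by (subst has_sum_reindex) (auto simp: o_def gm intro: has_sum_cmult_right)
  qed
  have disj: "E a \<inter> E b = {}" if ab: "a \<in> A" "b \<in> A" "a \<noteq> b" for a b
  proof (rule ccontr)
    assume "E a \<inter> E b \<noteq> {}"
    then obtain m m' where m: "m \<in> smooth_numbers (Qa a)" "m' \<in> smooth_numbers (Qa b)" "a * m = b * m'"
      by (auto simp: E_def)
    then have "a dvd b \<or> b dvd a" using ab A
      by (intro dvd_or_dvd_of_common_multiple[of a b m m']) (auto simp: smooth_numbers_def Qa_def)
    then show False using A ab by (auto simp: primitive_set_def)
  qed
  have sub: "E a \<subseteq> smooth_numbers Q" if "a \<in> A" for a
  proof
    fix n assume "n \<in> E a"
    then obtain m where m: "m \<in> smooth_numbers (Qa a)" "n = a * m" by (auto simp: E_def)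
    have a: "a \<ge> 2" using that A by auto
    have "prime_factors n = prime_factors a \<union> prime_factors m"
      using m a by (auto simp: smooth_numbers_def prime_factors_product)
    moreover have "p \<le> N" if "p \<in> prime_factors a" for p
      using that N[OF \<open>a \<in> A\<close>] a by (auto dest!: dvd_imp_le)
    moreover have "prime_factors m \<subseteq> Q" using m by (auto simp: smooth_numbers_def Q_def Qa_def)
    ultimately have "prime_factors n \<subseteq> Q" by (auto simp: Q_def)
    then show "n \<in> smooth_numbers Q" using m a by (auto simp: smooth_numbers_def)
  qed
  have U: "(g has_sum (\<Sum>a\<in>B. g a * (\<Prod>p\<in>Qa a. 1 / (1 - g p)))) (\<Union>a\<in>B. E a)" if "B \<subseteq> A" for B
    using finite_subset[OF that A(1)] that
  proof (induction B)
    case (insert b B)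
    have "E b \<inter> (\<Union>a\<in>B. E a) = {}" using disj[of b] insert by blast
    then show ?case using insert sE[of b] by (simp add: has_sum_Un_disjoint)
  qed simp
  have "(g has_sum (\<Prod>p\<in>Q. 1 / (1 - g p))) (smooth_numbers Q)"
    by (rule has_sum_euler_product[OF fin(1) _ g1 gm g0]) (auto simp: Q_def gp1)
  then have le: "(\<Sum>a\<in>A. g a * (\<Prod>p\<in>Qa a. 1 / (1 - g p))) \<le> (\<Prod>p\<in>Q. 1 / (1 - g p))"
    by (rule has_sum_mono2[OF U[OF order_refl]]) (use sub g0 in auto)
  have pos: "(\<Prod>p\<in>Q. 1 - g p) > 0" using gp1 by (intro prod_pos) (auto simp: Q_def)
  have "(\<Sum>a\<in>A. z ^ prime_Omega a / a * (\<Prod>p | prime p \<and> p < max_prime a. 1 - z / p))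
      = (\<Sum>a\<in>A. (\<Prod>p\<in>Q. 1 - g p) * (g a * (\<Prod>p\<in>Qa a. 1 / (1 - g p))))"
  proof (rule sum.cong[OF refl])
    fix a assume "a \<in> A"
    then have a: "a \<ge> 2" "a \<le> N" using A N by auto
    then have P: "max_prime a \<le> N" using max_prime(1)[of a] by (auto dest!: dvd_imp_le)
    \<comment> \<open>Of the Euler factors over Q, those at primes from \<open>max_prime a\<close>
      on cancel against \<open>I\<close>; exactly the product \<open>X\<close> over the smaller
      primes survives.\<close>
    have split: "Q = {p. prime p \<and> p < max_prime a} \<union> Qa a" using P by (auto simp: Q_def Qa_def)
    define X where "X = (\<Prod>p | prime p \<and> p < max_prime a. 1 - g p)"
    define Y where "Y = (\<Prod>p\<in>Qa a. 1 - g p)"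
    define I where "I = (\<Prod>p\<in>Qa a. 1 / (1 - g p))"
    have XY: "(\<Prod>p\<in>Q. 1 - g p) = X * Y"
      unfolding split X_def Y_def using fin(2) by (intro prod.union_disjoint) (auto simp: Qa_def)
    have YI: "Y * I = 1"
      unfolding Y_def I_def prod.distrib[symmetric] by (intro prod.neutral ballI cancel) (simp add: Qa_def)
    have X: "X = (\<Prod>p | prime p \<and> p < max_prime a. 1 - z / p)"
      unfolding X_def by (intro prod.cong) (auto simp: gp)
    have ga: "z ^ prime_Omega a / a = g a" by (simp add: g_def)
    have "g a * X = X * Y * (g a * I)" using YI by (simp add: mult_ac)
    then show "z ^ prime_Omega a / a * (\<Prod>p | prime p \<and> p < max_prime a. 1 - z / p)
        = (\<Prod>p\<in>Q. 1 - g p) * (g a * (\<Prod>p\<in>Qa a. 1 / (1 - g p)))"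
      unfolding XY I_def[symmetric] X[symmetric] ga .
  qed
  also have "\<dots> = (\<Prod>p\<in>Q. 1 - g p) * (\<Sum>a\<in>A. g a * (\<Prod>p\<in>Qa a. 1 / (1 - g p)))"
    by (simp add: sum_distrib_left)
  also have "\<dots> \<le> (\<Prod>p\<in>Q. 1 - g p) * (\<Prod>p\<in>Q. 1 / (1 - g p))"
    using le pos by (intro mult_left_mono) auto
  also have "\<dots> = 1"
    unfolding prod.distrib[symmetric] by (intro prod.neutral ballI cancel) (simp add: Q_def)
  finally show ?thesis .
qed

section \<open>Mertens' product and the uniform bound for primitive sets\<close>

text \<open>The logarithm of the product is at least - z * (sum of 1/p) - 2 * z * (sum of 1/p^2).
  The sums are at most ln (ln a) + 14 and 2, whence 18 = 14 + 4.\<close>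

lemma prod_primes_lower_bound:
  fixes z :: real
  assumes a: "a \<ge> 2" and z: "0 < z" "z \<le> 1"
  shows "1 / ln a powr z \<le> exp (18 * z) * (\<Prod>p | prime p \<and> p < max_prime a. 1 - z / p)"
proof (cases "max_prime a \<ge> 3")
  \<comment> \<open>Here a is a power of 2 and the product is empty. The left-hand side can still
    exceed 1, because ln 2 < 1; the bound exp (-1) \<le> ln 2 absorbs this.\<close>
  case False
  have "{p. prime p \<and> p < max_prime a} = {}" using False by (auto dest: prime_ge_2_nat)
  moreover have "1 / ln a powr z \<le> exp (18 * z)"
  proof -
    have "exp (-1) \<le> (1/2 :: real)" using exp_ge_add_one_self[of "1::real"] by (simp add: exp_minus field_simps)
    also have "\<dots> \<le> ln 2" using ln2_ge_two_thirds by simp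
    also have "\<dots> \<le> ln a" using a by simp
    finally have "exp (-1) \<le> ln a" .
    then have "exp (-1) powr z \<le> ln a powr z" using z by (intro powr_mono2) auto
    then have "exp (-z) \<le> ln a powr z" by (simp add: powr_def)
    moreover have "ln (real a) > 0" using a by simp
    ultimately have "1 / ln a powr z \<le> 1 / exp (-z)" by (intro divide_left_mono) auto
    also have "\<dots> = exp z" by (simp add: exp_minus divide_inverse)
    also have "\<dots> \<le> exp (18 * z)" using z by simp
    finally show ?thesis .
  qed
  ultimately show ?thesis by (simp only: prod.empty mult_1_right)
next
  case True
  define q where "q = max_prime a"
  define R where "R = {p. prime p \<and> p < q}"
  have R: "finite R" "\<And>p. p \<in> R \<Longrightarrow> prime p" by (auto simp: R_def)
  have qa: "q \<le> a" using max_prime(1)[OF a] a by (auto simp: q_def dest!: dvd_imp_le)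
  have q3: "q \<ge> 3" using True by (simp add: q_def)
  then have lnq: "ln (real q) > 0" by simp
  have R1: "(\<Sum>p\<in>R. 1 / real p) \<le> ln (ln a) + 14"
  proof -
    have "(\<Sum>p\<in>R. 1 / real p) \<le> ln (ln q) + 14"
      using q3 by (intro sum_prime_reciprocals_le R(1)) (auto simp: R_def)
    moreover have "ln (ln q) \<le> ln (ln a)" using lnq qa q3 by (intro ln_mono) simp_all
    ultimately show ?thesis by simp
  qed
  have R2: "(\<Sum>p\<in>R. real p powr (-2)) \<le> 2"
  proof -
    have "(\<Sum>p\<in>R. real p powr (-2)) \<le> dseries {1..} (1 + 1)"
      unfolding dseries_def using finite_sum_le_infsum[OF summable_on_powr[of 2], of R "{1..}"] R(1) R(2)[THEN prime_ge_1_nat]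
      by auto
    also have "\<dots> \<le> 2" using zeta_bounds(2)[of 1] by simp
    finally show ?thesis .
  qed
  have zp: "0 \<le> z / p" "z / p \<le> 1/2" if "p \<in> R" for p
    using R(2)[OF that] z prime_ge_2_nat[of p] by (auto simp: field_simps)
  have "(\<Sum>p\<in>R. - (z / p) - 2 * (z / p)\<^sup>2) \<ge> - z * (\<Sum>p\<in>R. 1 / real p) - 2 * z * (\<Sum>p\<in>R. real p powr (-2))"
  proof -
    have "- z * (\<Sum>p\<in>R. 1 / real p) - 2 * z * (\<Sum>p\<in>R. real p powr (-2))
        = (\<Sum>p\<in>R. - (z / p) - 2 * z * real p powr (-2))"
      by (simp add: sum_distrib_left sum_subtractf sum_negf)
    also have "\<dots> \<le> (\<Sum>p\<in>R. - (z / p) - 2 * (z / p)\<^sup>2)"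
    proof (rule sum_mono)
      fix p assume "p \<in> R"
      then have p0: "real p > 0" using R(2) prime_gt_0_nat by auto
      \<comment> \<open>Giving up one factor z by z \<le> 1 keeps the quadratic error proportional
        to z.\<close>
      have "(z / p)\<^sup>2 = (z * z) * real p powr (-2)"
        using p0 by (simp add: powr_minus_divide power2_eq_square)
      also have "\<dots> \<le> z * real p powr (-2)" using z by (intro mult_right_mono) (auto simp: mult_left_le)
      finally show "- (z / p) - 2 * z * real p powr (-2) \<le> - (z / p) - 2 * (z / p)\<^sup>2" by simp
    qed
    finally show ?thesis .
  qed
  moreover have "z * (\<Sum>p\<in>R. 1 / real p) \<le> z * (ln (ln a) + 14)" using R1 z by (intro mult_left_mono) auto
  moreover have "2 * z * (\<Sum>p\<in>R. real p powr (-2)) \<le> 2 * z * 2" using R2 z by (intro mult_left_mono) auto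
  ultimately have S: "- z * ln (ln a) \<le> 18 * z + (\<Sum>p\<in>R. - (z / p) - 2 * (z / p)\<^sup>2)"
    by (simp add: algebra_simps)
  have "ln (real a) \<noteq> 0" using a by simp
  then have "1 / ln a powr z = exp (- z * ln (ln a))"
    by (simp add: powr_def exp_minus divide_inverse)
  also have "\<dots> \<le> exp (18 * z + (\<Sum>p\<in>R. - (z / p) - 2 * (z / p)\<^sup>2))" using S by simp
  also have "\<dots> = exp (18 * z) * (\<Prod>p\<in>R. exp (- (z / p) - 2 * (z / p)\<^sup>2))"
    using R by (simp add: exp_add exp_sum)
  also have "\<dots> \<le> exp (18 * z) * (\<Prod>p\<in>R. 1 - z / p)"
    using exp_le_one_minus zp by (intro mult_left_mono prod_mono) auto
  finally show ?thesis by (simp add: R_def q_def)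
qed

text \<open>The right-hand side does not depend on A. This uniformity is what allows the bound to be
  applied to each layer of minimal elements of an arbitrary set.\<close>

lemma f_sum_primitive_le:
  assumes "A \<subseteq> {2..}" "primitive_set A" and z: "0 < z" "z \<le> 1"
  shows "f_sum z A \<le> ennreal (exp (18 * z))"
  unfolding f_sum_def
proof (subst nonneg_infsum_complete)
  show "(SUP F\<in>{F. finite F \<and> F \<subseteq> A}. \<Sum>a\<in>F. ennreal (z ^ prime_Omega a / (real a * ln (real a) powr z)))
    \<le> ennreal (exp (18 * z))"
  proof (rule SUP_least, clarify)
    fix F assume F: "finite F" "F \<subseteq> A"
    then have F': "F \<subseteq> {2..}" "primitive_set F" using assms unfolding primitive_set_def by blast+
    let ?P = "\<lambda>a. \<Prod>p | prime p \<and> p < max_prime a. 1 - z / real p"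
    have "(\<Sum>a\<in>F. z ^ prime_Omega a / (real a * ln (real a) powr z))
      \<le> (\<Sum>a\<in>F. exp (18 * z) * (z ^ prime_Omega a / a * ?P a))"
    proof (rule sum_mono)
      fix a assume "a \<in> F"
      then have a: "a \<ge> 2" using F' by auto
      have "z ^ prime_Omega a / a * (1 / ln a powr z) \<le> z ^ prime_Omega a / a * (exp (18 * z) * ?P a)"
        using prod_primes_lower_bound[OF a z] z by (intro mult_left_mono) auto
      then show "z ^ prime_Omega a / (real a * ln (real a) powr z)
        \<le> exp (18 * z) * (z ^ prime_Omega a / a * ?P a)"
        by (simp add: mult_ac)
    qed
    also have "\<dots> = exp (18 * z) * (\<Sum>a\<in>F. z ^ prime_Omega a / a * ?P a)"
      by (simp add: sum_distrib_left)
    also have "\<dots> \<le> exp (18 * z) * 1"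
      by (intro mult_left_mono primitive_sum_prod_le_1 F F' z) auto
    finally show "(\<Sum>a\<in>F. ennreal (z ^ prime_Omega a / (real a * ln (real a) powr z))) \<le> ennreal (exp (18 * z))"
      using z by (subst sum_ennreal) (auto intro!: ennreal_leI divide_nonneg_nonneg)
  qed
qed simp

section \<open>Almost primes\<close>

text \<open>A general Q is carried along because the set without infinite chains is built from
  almost primes all of whose prime factors are large.\<close>

definition smooth_almost_primes :: "nat set \<Rightarrow> nat \<Rightarrow> nat set" where
  "smooth_almost_primes Q k = {n \<in> smooth_numbers Q. prime_Omega n = k}"

lemma smooth_almost_primes_primes: "smooth_almost_primes {p. prime p} k = almost_primes k"
  by (auto simp: smooth_almost_primes_def smooth_numbers_def almost_primes_def)

lemma prime_Omega_prime_power: "prime p \<Longrightarrow> prime_Omega (p ^ j) = j"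
  by (simp add: prime_Omega_def prime_factorization_prime_power)

lemma prime_Omega_eq_0_iff: "n \<ge> 1 \<Longrightarrow> prime_Omega n = 0 \<longleftrightarrow> n = 1"
  by (auto simp: prime_Omega_def prime_factorization_empty_iff)

lemma smooth_almost_primes_0: "smooth_almost_primes Q 0 = {1}"
  by (auto simp: smooth_almost_primes_def smooth_numbers_def prime_Omega_eq_0_iff)

lemma smooth_almost_primes_1:
  assumes "Q \<subseteq> {p. prime p}"
  shows "smooth_almost_primes Q 1 = Q"
proof (intro equalityI subsetI)
  fix n assume n: "n \<in> smooth_almost_primes Q 1"
  then have "size (prime_factorization n) = 1" by (simp add: smooth_almost_primes_def prime_Omega_def)
  then obtain p where p: "prime_factorization n = {#p#}" using size_1_singleton_mset by blast
  have n0: "n \<noteq> 0" using n by (auto simp: smooth_almost_primes_def smooth_numbers_def)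
  have "n = p" using prod_mset_prime_factorization[OF n0] p by simp
  then show "n \<in> Q" using n p by (auto simp: smooth_almost_primes_def smooth_numbers_def)
next
  fix p assume "p \<in> Q"
  then show "p \<in> smooth_almost_primes Q 1"
    using assms prime_ge_1_nat by (auto simp: smooth_almost_primes_def smooth_numbers_def prime_Omega_prime prime_factorization_prime)
qed

lemma bij_betw_smooth_almost_primes_shift:
  assumes "prime p" "p \<in> Q"
  shows "bij_betw (\<lambda>m. p ^ j * m) (smooth_almost_primes Q k) {n \<in> smooth_almost_primes Q (k + j). p ^ j dvd n}"
proof -
  have p0: "p > 0" using assms prime_gt_0_nat by auto
  have "p ^ j * m \<in> smooth_almost_primes Q (k + j) \<longleftrightarrow> m \<in> smooth_almost_primes Q k" for m
    using assms p0
    by (cases "m = 0")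
       (auto simp: smooth_almost_primes_def smooth_numbers_def prime_Omega_mult prime_Omega_prime_power
          prime_factorization_mult prime_factorization_prime_power Suc_le_eq split: if_splits)
  moreover have "inj_on (\<lambda>m. p ^ j * m) (smooth_almost_primes Q k)" using p0 by (auto intro: inj_onI)
  ultimately show ?thesis unfolding bij_betw_def by (auto elim!: dvdE)
qed

section \<open>A recursion in the number of prime factors\<close>

text \<open>Double counting of the pairs (p, n) with p^j dividing n, where n = p^j * m. In
  \<open>ennreal\<close> the two sums may be swapped unconditionally. The cases j = 1 and j = 2
  yield the lower and upper recursion for the Dirichlet series.\<close>

lemma infsum_card_power_divisors:
  assumes Q: "Q \<subseteq> {p. prime p}" and j: "j \<ge> 1"
  shows "(\<Sum>\<^sub>\<infinity>n\<in>smooth_almost_primes Q (k + j). of_nat (card {p\<in>Q. p ^ j dvd n}) * ennreal (real n powr (-s)))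
    = (\<Sum>\<^sub>\<infinity>p\<in>Q. ennreal (real (p ^ j) powr (-s))) * (\<Sum>\<^sub>\<infinity>n\<in>smooth_almost_primes Q k. ennreal (real n powr (-s)))"
    (is "?l = _ * ?E")
proof -
  let ?A = "smooth_almost_primes Q (k + j)"
  have "?l = (\<Sum>\<^sub>\<infinity>n\<in>?A. \<Sum>\<^sub>\<infinity>p\<in>Q. if p ^ j dvd n then ennreal (real n powr (-s)) else 0)"
  proof (rule infsum_cong)
    fix n assume "n \<in> ?A"
    then have n: "n > 0" by (auto simp: smooth_almost_primes_def smooth_numbers_def)
    have "{p\<in>Q. p ^ j dvd n} \<subseteq> {..n}"
    proof clarify
      fix p assume p: "p \<in> Q" "p ^ j dvd n"
      have "p \<ge> 1" using p Q prime_ge_1_nat by auto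
      then have "p \<le> p ^ j" using j by (simp add: self_le_power)
      also have "\<dots> \<le> n" using p n by (auto intro: dvd_imp_le)
      finally show "p \<le> n" .
    qed
    then have fin: "finite {p\<in>Q. p ^ j dvd n}" by (rule finite_subset) simp
    have "(\<Sum>\<^sub>\<infinity>p\<in>Q. if p ^ j dvd n then ennreal (real n powr (-s)) else 0)
      = (\<Sum>\<^sub>\<infinity>p\<in>{p\<in>Q. p ^ j dvd n}. ennreal (real n powr (-s)))"
      by (rule infsum_cong_neutral) auto
    also have "\<dots> = of_nat (card {p\<in>Q. p ^ j dvd n}) * ennreal (real n powr (-s))"
      using fin by simp
    finally show "of_nat (card {p\<in>Q. p ^ j dvd n}) * ennreal (real n powr (-s))
      = (\<Sum>\<^sub>\<infinity>p\<in>Q. if p ^ j dvd n then ennreal (real n powr (-s)) else 0)" by simp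
  qed
  also have "\<dots> = (\<Sum>\<^sub>\<infinity>p\<in>Q. \<Sum>\<^sub>\<infinity>n\<in>?A. if p ^ j dvd n then ennreal (real n powr (-s)) else 0)"
    by (rule infsum_swap_ennreal)
  also have "\<dots> = (\<Sum>\<^sub>\<infinity>p\<in>Q. ?E * ennreal (real (p ^ j) powr (-s)))"
  proof (rule infsum_cong)
    fix p assume p: "p \<in> Q"
    have "(\<Sum>\<^sub>\<infinity>n\<in>?A. if p ^ j dvd n then ennreal (real n powr (-s)) else 0)
      = (\<Sum>\<^sub>\<infinity>n\<in>{n\<in>?A. p ^ j dvd n}. ennreal (real n powr (-s)))"
      by (rule infsum_cong_neutral) auto
    also have "\<dots> = (\<Sum>\<^sub>\<infinity>m\<in>smooth_almost_primes Q k. ennreal (real (p ^ j * m) powr (-s)))"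
      using p Q by (intro infsum_reindex_bij_betw[symmetric] bij_betw_smooth_almost_primes_shift) auto
    also have "\<dots> = (\<Sum>\<^sub>\<infinity>m\<in>smooth_almost_primes Q k. ennreal (real (p ^ j) powr (-s)) * ennreal (real m powr (-s)))"
      by (simp add: powr_mult ennreal_mult')
    also have "\<dots> = ?E * ennreal (real (p ^ j) powr (-s))"
      unfolding infsum_cmult_ennreal by (rule mult.commute)
    finally show "(\<Sum>\<^sub>\<infinity>n\<in>?A. if p ^ j dvd n then ennreal (real n powr (-s)) else 0)
      = ?E * ennreal (real (p ^ j) powr (-s))" .
  qed
  also have "\<dots> = (\<Sum>\<^sub>\<infinity>p\<in>Q. ennreal (real (p ^ j) powr (-s))) * ?E"
    unfolding infsum_cmult_ennreal by (rule mult.commute)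
  finally show ?thesis .
qed

lemma card_prime_divisors_le_prime_Omega:
  assumes "n > 0" "Q \<subseteq> {p. prime p}"
  shows "card {p\<in>Q. p dvd n} \<le> prime_Omega n"
proof -
  have "card {p\<in>Q. p dvd n} \<le> card (prime_factors n)"
    using assms by (intro card_mono) (auto simp: prime_factors_dvd)
  also have "\<dots> \<le> prime_Omega n"
    unfolding prime_Omega_def size_multiset_overloaded_eq card_eq_sum by (intro sum_mono) (auto simp: Suc_le_eq)
  finally show ?thesis .
qed

text \<open>A prime dividing n exactly once contributes 1 to both sides. A repeated prime is charged
  all of \<open>prime_Omega n\<close>, which is crude but affordable: numbers with square divisors
  turn out to be of lower order.\<close>

lemma prime_Omega_le_card_prime_divisors:
  assumes n: "n > 0" and Q: "prime_factors n \<subseteq> Q" "Q \<subseteq> {p. prime p}"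
  shows "prime_Omega n \<le> card {p\<in>Q. p dvd n} + prime_Omega n * card {p\<in>Q. p ^ 2 dvd n}"
proof -
  let ?M = "prime_factorization n"
  have 1: "{p\<in>Q. p dvd n} = set_mset ?M"
    using n Q by (auto simp: prime_factors_dvd)
  have 2: "{p\<in>Q. p ^ 2 dvd n} = {p \<in> set_mset ?M. 2 \<le> count ?M p}"
  proof (intro equalityI subsetI)
    fix p assume "p \<in> {p\<in>Q. p ^ 2 dvd n}"
    then have p: "prime p" "p ^ 2 dvd n" using Q by auto
    then have "2 \<le> multiplicity p n" using n by (intro multiplicity_geI) auto
    then have c: "2 \<le> count ?M p" using p(1) by (simp add: count_prime_factorization_prime)
    then have "p \<in># ?M" by (intro count_inI) auto
    with c show "p \<in> {p \<in> set_mset ?M. 2 \<le> count ?M p}" by simp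
  next
    fix p assume p: "p \<in> {p \<in> set_mset ?M. 2 \<le> count ?M p}"
    then have "prime p" by auto
    then have "2 \<le> multiplicity p n" using p by (simp add: count_prime_factorization_prime)
    then have "p ^ 2 dvd n" by (rule multiplicity_dvd')
    then show "p \<in> {p\<in>Q. p ^ 2 dvd n}" using p Q(1) by blast
  qed
  have "prime_Omega n = (\<Sum>p\<in>set_mset ?M. count ?M p)"
    by (simp add: prime_Omega_def size_multiset_overloaded_eq)
  also have "\<dots> \<le> (\<Sum>p\<in>set_mset ?M. 1 + (if 2 \<le> count ?M p then prime_Omega n else 0))"
  proof (rule sum_mono)
    fix p assume "p \<in> set_mset ?M"
    have "count ?M p \<le> prime_Omega n" by (simp add: prime_Omega_def count_le_size)
    then show "count ?M p \<le> 1 + (if 2 \<le> count ?M p then prime_Omega n else 0)" by simp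
  qed
  also have "\<dots> = card (set_mset ?M) + prime_Omega n * card {p \<in> set_mset ?M. 2 \<le> count ?M p}"
    unfolding sum.distrib by (simp add: sum.If_cases Int_def)
  finally show ?thesis unfolding 1 2 .
qed

lemma ennreal_dseries: "s > 1 \<Longrightarrow> ennreal (dseries A s) = (\<Sum>\<^sub>\<infinity>a\<in>A. ennreal (real a powr (-s)))"
  unfolding dseries_def by (intro ennreal_infsum summable_on_powr) auto

text \<open>In the double count with j = 1, each n is hit once for each distinct prime divisor in Q,
  so at most k + 1 times.\<close>

lemma dseries_almost_primes_lower:
  assumes Q: "Q \<subseteq> {p. prime p}" and s: "s > 1"
  shows "dseries Q s * dseries (smooth_almost_primes Q k) s \<le> real (k + 1) * dseries (smooth_almost_primes Q (k + 1)) s"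
proof -
  let ?A = "smooth_almost_primes Q"
  have "ennreal (dseries Q s * dseries (?A k) s) =
      (\<Sum>\<^sub>\<infinity>n\<in>?A (k + 1). of_nat (card {p\<in>Q. p ^ 1 dvd n}) * ennreal (real n powr (-s)))"
    using infsum_card_power_divisors[OF Q, where j = 1 and k = k and s = s] s
    by (simp add: ennreal_mult dseries_nonneg ennreal_dseries)
  also have "\<dots> \<le> (\<Sum>\<^sub>\<infinity>n\<in>?A (k + 1). of_nat (k + 1) * ennreal (real n powr (-s)))"
  proof (rule infsum_mono_ennreal[OF order_refl], rule mult_right_mono)
    fix n assume "n \<in> ?A (k + 1)"
    then have "card {p\<in>Q. p ^ 1 dvd n} \<le> k + 1"
      using card_prime_divisors_le_prime_Omega[of n Q] Q
      by (auto simp: smooth_almost_primes_def smooth_numbers_def)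
    then show "of_nat (card {p\<in>Q. p ^ 1 dvd n}) \<le> (of_nat (k + 1) :: ennreal)"
      by (rule of_nat_mono)
  qed simp
  also have "\<dots> = ennreal (real (k + 1)) * ennreal (dseries (?A (k + 1)) s)"
    unfolding infsum_cmult_ennreal ennreal_dseries[OF s] by (simp add: ennreal_of_nat_eq_real_of_nat del: of_nat_Suc of_nat_add)
  also have "\<dots> = ennreal (real (k + 1) * dseries (?A (k + 1)) s)"
    by (simp add: ennreal_mult' dseries_nonneg)
  finally show ?thesis by (subst (asm) ennreal_le_iff) (auto simp: dseries_nonneg)
qed

text \<open>The converse up to repeated primes. The double count with j = 2 bounds these by zeta(2)
  \<le> 2 times the series for k, which is smaller than the left-hand side by two powers of - ln
  t.\<close>

lemma dseries_almost_primes_upper: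
  assumes Q: "Q \<subseteq> {p. prime p}" and s: "s > 1"
  shows "real (k + 2) * dseries (smooth_almost_primes Q (k + 2)) s \<le>
    dseries Q s * dseries (smooth_almost_primes Q (k + 1)) s + real (k + 2) * (2 * dseries (smooth_almost_primes Q k) s)"
proof -
  let ?A = "smooth_almost_primes Q"
  let ?c = "\<lambda>j n. of_nat (card {p\<in>Q. p ^ j dvd n}) * ennreal (real n powr (-s))"
  have squares: "(\<Sum>\<^sub>\<infinity>p\<in>Q. ennreal (real (p ^ 2) powr (-s))) \<le> ennreal 2"
  proof -
    have "(\<Sum>\<^sub>\<infinity>p\<in>Q. ennreal (real (p ^ 2) powr (-s))) \<le> (\<Sum>\<^sub>\<infinity>p\<in>{1..}. ennreal (real p powr (-2)))"
    proof (rule infsum_mono_ennreal)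
      show "Q \<subseteq> {1..}" using Q by (auto dest!: subsetD prime_ge_1_nat)
      fix p assume "p \<in> Q"
      then have "prime p" using Q by auto
      then have p: "real p \<ge> 1" using prime_ge_1_nat[of p] by simp
      have "real (p ^ 2) powr (-s) = real p powr (-(2 * s))"
        using p by (simp add: power2_eq_square powr_mult powr_add[symmetric])
      also have "\<dots> \<le> real p powr (-2)" using p s by (intro powr_mono) auto
      finally show "ennreal (real (p ^ 2) powr (-s)) \<le> ennreal (real p powr (-2))" by (rule ennreal_leI)
    qed
    also have "\<dots> = ennreal (dseries {1..} 2)" by (subst ennreal_dseries) auto
    also have "\<dots> \<le> ennreal 2" using zeta_bounds(2)[of 1] by (intro ennreal_leI) simp
    finally show "(\<Sum>\<^sub>\<infinity>p\<in>Q. ennreal (real (p ^ 2) powr (-s))) \<le> ennreal 2" .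
  qed
  have "ennreal (real (k + 2) * dseries (?A (k + 2)) s) = ennreal (real (k + 2)) * ennreal (dseries (?A (k + 2)) s)"
    by (simp add: ennreal_mult' dseries_nonneg)
  also have "\<dots> = (\<Sum>\<^sub>\<infinity>n\<in>?A (k + 2). of_nat (k + 2) * ennreal (real n powr (-s)))"
    unfolding infsum_cmult_ennreal ennreal_dseries[OF s] by (simp add: ennreal_of_nat_eq_real_of_nat del: of_nat_Suc of_nat_add)
  also have "\<dots> \<le> (\<Sum>\<^sub>\<infinity>n\<in>?A (k + 2). ?c 1 n + of_nat (k + 2) * ?c 2 n)"
  proof (rule infsum_mono_ennreal[OF order_refl])
    fix n assume n: "n \<in> ?A (k + 2)"
    then have "k + 2 \<le> card {p\<in>Q. p ^ 1 dvd n} + (k + 2) * card {p\<in>Q. p ^ 2 dvd n}"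
      using prime_Omega_le_card_prime_divisors[of n Q] Q
      by (auto simp: smooth_almost_primes_def smooth_numbers_def)
    then have "(of_nat (k + 2) :: ennreal) \<le> of_nat (card {p\<in>Q. p ^ 1 dvd n} + (k + 2) * card {p\<in>Q. p ^ 2 dvd n})"
      by (rule of_nat_mono)
    then have "(of_nat (k + 2) :: ennreal) * ennreal (real n powr (-s))
      \<le> of_nat (card {p\<in>Q. p ^ 1 dvd n} + (k + 2) * card {p\<in>Q. p ^ 2 dvd n}) * ennreal (real n powr (-s))"
      by (rule mult_right_mono) simp
    also have "\<dots> = ?c 1 n + of_nat (k + 2) * ?c 2 n"
      by (simp only: of_nat_add[of "card {p\<in>Q. p ^ 1 dvd n}"] of_nat_mult[of "k + 2"] distrib_right[of _ "of_nat (k + 2) * _"] mult.assoc)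
    finally show "(of_nat (k + 2) :: ennreal) * ennreal (real n powr (-s)) \<le> ?c 1 n + of_nat (k + 2) * ?c 2 n" .
  qed
  also have "\<dots> = (\<Sum>\<^sub>\<infinity>n\<in>?A (k + 1 + 1). ?c 1 n) + of_nat (k + 2) * (\<Sum>\<^sub>\<infinity>n\<in>?A (k + 2). ?c 2 n)"
    unfolding infsum_add_ennreal infsum_cmult_ennreal by (simp add: numeral_2_eq_2)
  also have "\<dots> = (\<Sum>\<^sub>\<infinity>p\<in>Q. ennreal (real p powr (-s))) * ennreal (dseries (?A (k + 1)) s)
      + of_nat (k + 2) * ((\<Sum>\<^sub>\<infinity>p\<in>Q. ennreal (real (p ^ 2) powr (-s))) * ennreal (dseries (?A k) s))"
    using infsum_card_power_divisors[OF Q, where j = 1 and k = "k + 1" and s = s] infsum_card_power_divisors[OF Q, where j = 2 and k = k and s = s]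
    by (simp add: ennreal_dseries s del: of_nat_Suc of_nat_add of_nat_power)
  also have "\<dots> \<le> ennreal (dseries Q s) * ennreal (dseries (?A (k + 1)) s)
      + of_nat (k + 2) * (ennreal 2 * ennreal (dseries (?A k) s))"
    unfolding ennreal_dseries[OF s, of Q]
    by (rule add_left_mono, rule mult_left_mono, rule mult_right_mono[OF squares]) simp_all
  also have "\<dots> = ennreal (dseries Q s * dseries (?A (k + 1)) s + real (k + 2) * (2 * dseries (?A k) s))"
    unfolding ennreal_of_nat_eq_real_of_nat using dseries_nonneg
    by (simp add: ennreal_mult ennreal_plus add_nonneg_nonneg mult_nonneg_nonneg del: ennreal_numeral)
  finally show ?thesis
    using dseries_nonneg by (subst (asm) ennreal_le_iff) (auto intro!: add_nonneg_nonneg mult_nonneg_nonneg)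
qed

section \<open>Asymptotics of the Dirichlet series at the pole\<close>

lemma filterlim_minus_ln_at_right_0: "filterlim (\<lambda>t::real. - ln t) at_top (at_right 0)"
  using ln_at_0 by (simp add: filterlim_uminus_at_bot)

text \<open>Each omitted prime changes the series by at most 1, and a bounded change is invisible
  next to - ln t.\<close>

lemma dseries_cofinite_primes_asymp:
  assumes Q: "Q \<subseteq> {p. prime p}" "finite ({p. prime p} - Q)"
  shows "((\<lambda>t. dseries Q (1 + t) / (- ln t)) \<longlongrightarrow> 1) (at_right 0)"
proof -
  let ?R = "{p. prime p} - Q"
  have b: "- ln t - (4 + card ?R) \<le> dseries Q (1 + t) \<and> dseries Q (1 + t) \<le> - ln t + 1" if t: "0 < t" "t \<le> 1" for t
  proof
    have "dseries {p. prime p} (1 + t) = dseries Q (1 + t) + dseries ?R (1 + t)"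
    proof -
      have U: "Q \<union> ?R = {p. prime p}" using Q by auto
      have "dseries (Q \<union> ?R) (1 + t) = dseries Q (1 + t) + dseries ?R (1 + t)"
        unfolding dseries_def using t by (intro infsum_Un_disjoint summable_on_powr) auto
      then show ?thesis unfolding U .
    qed
    moreover have "dseries ?R (1 + t) \<le> card ?R"
    proof -
      have "dseries ?R (1 + t) = (\<Sum>p\<in>?R. real p powr (-(1 + t)))" using Q by (simp add: dseries_def)
      also have "\<dots> \<le> (\<Sum>p\<in>?R. 1)"
      proof (rule sum_mono)
        fix p assume "p \<in> ?R"
        then have "real p powr (-(1 + t)) \<le> 1/2" using t by (intro prime_powr_le_half) auto
        then show "real p powr (-(1 + t)) \<le> 1" by simp
      qed
      finally show ?thesis by simp
    qed
    ultimately show "- ln t - (4 + card ?R) \<le> dseries Q (1 + t)"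
      using prime_dseries_bounds(2)[of t] t by simp
    show "dseries Q (1 + t) \<le> - ln t + 1"
      using prime_dseries_bounds(1)[of t] dseries_mono[of "1 + t" Q "{p. prime p}"] t Q by simp
  qed
  have ev: "\<forall>\<^sub>F t::real in at_right 0. 0 < t \<and> t < 1/2"
    unfolding eventually_at_right_field by (intro exI[of _ "1/2"]) auto
  have lim: "((\<lambda>t::real. 1 + c / (- ln t)) \<longlongrightarrow> 1) (at_right 0)" for c
  proof -
    have "((\<lambda>t::real. c / (- ln t)) \<longlongrightarrow> 0) (at_right 0)"
      by (rule tendsto_divide_0[OF tendsto_const])
         (use filterlim_minus_ln_at_right_0 in \<open>rule filterlim_at_top_imp_at_infinity\<close>)
    from tendsto_add[OF tendsto_const[of 1] this] show ?thesis by simp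
  qed
  show ?thesis
  proof (rule tendsto_sandwich[OF _ _ lim[of "- (4 + real (card ?R))"] lim[of 1]])
    show "\<forall>\<^sub>F t in at_right 0. 1 + - (4 + real (card ?R)) / (- ln t) \<le> dseries Q (1 + t) / (- ln t)"
      using ev
    proof eventually_elim
      case (elim t)
      then have l: "- ln t > 0" by simp
      then have "1 + - (4 + real (card ?R)) / (- ln t) = (- ln t - (4 + card ?R)) / (- ln t)"
        by (simp add: field_simps)
      also have "\<dots> \<le> dseries Q (1 + t) / (- ln t)"
        using b[of t] elim l by (intro divide_right_mono) auto
      finally show ?case .
    qed
    show "\<forall>\<^sub>F t in at_right 0. dseries Q (1 + t) / (- ln t) \<le> 1 + 1 / (- ln t)"
      using ev
    proof eventually_elim
      case (elim t)
      then have l: "- ln t > 0" by simp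
      have "dseries Q (1 + t) / (- ln t) \<le> (- ln t + 1) / (- ln t)"
        using b[of t] elim l by (intro divide_right_mono) auto
      also have "\<dots> = 1 + 1 / (- ln t)" using l by (simp add: field_simps)
      finally show ?case .
    qed
  qed
qed

text \<open>Divided by (- ln t)^k, the two recursions enclose the quotient for k between (quotient
  of \<open>Q\<close>) * (quotient for k - 1) / k and the same plus 2 * (quotient for k - 2) / (ln
  t)^2. The limit is 1 / (k * (k - 1)!). The correction reaches back two steps, hence the strong
  induction.\<close>

lemma dseries_smooth_almost_primes_asymp:
  assumes Q: "Q \<subseteq> {p. prime p}" "finite ({p. prime p} - Q)"
  shows "((\<lambda>t. dseries (smooth_almost_primes Q k) (1 + t) / (- ln t) ^ k) \<longlongrightarrow> 1 / fact k) (at_right 0)"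
proof (induction k rule: less_induct)
  case (less k)
  let ?u = "\<lambda>k t. dseries (smooth_almost_primes Q k) (1 + t) / (- ln t) ^ k"
  note u1 = dseries_cofinite_primes_asymp[OF Q]
  consider "k = 0" | "k = 1" | j where "k = j + 2"
    by (metis One_nat_def add_2_eq_Suc' not0_implies_Suc)
  then show ?case
  proof cases
    case 1
    have "dseries {1} s = 1" for s by (simp add: dseries_def)
    then show ?thesis using 1 by (simp add: smooth_almost_primes_0[simplified])
  next
    case 2
    then show ?thesis using u1 smooth_almost_primes_1[OF Q(1)] by simp
  next
    case (3 j)
    let ?U = "\<lambda>t. dseries Q (1 + t) / (- ln t)"
    have ev: "\<forall>\<^sub>F t::real in at_right 0. 0 < t \<and> t < 1/2"
      unfolding eventually_at_right_field by (intro exI[of _ "1/2"]) auto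
    have IH1: "(?u (j + 1) \<longlongrightarrow> 1 / fact (j + 1)) (at_right 0)" and IH0: "(?u j \<longlongrightarrow> 1 / fact j) (at_right 0)"
      by (rule less.IH, simp add: 3)+
    have l1: "((\<lambda>t. ?U t * ?u (j + 1) t / real (j + 2)) \<longlongrightarrow> 1 * (1 / fact (j + 1)) / real (j + 2)) (at_right 0)"
      by (intro tendsto_intros u1 IH1) simp
    have l0: "((\<lambda>t. 2 * ?u j t / (- ln t)^2) \<longlongrightarrow> 0) (at_right 0)"
    proof (rule tendsto_divide_0[OF tendsto_mult[OF tendsto_const IH0]])
      show "filterlim (\<lambda>t::real. (- ln t)^2) at_infinity (at_right 0)"
        by (intro filterlim_at_top_imp_at_infinity filterlim_pow_at_top filterlim_minus_ln_at_right_0) simp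
    qed
    have e: "1 * (1 / fact (j + 1)) / real (j + 2) = 1 / (fact k :: real)"
      using 3 by (simp add: field_simps)
    note l1 = l1[unfolded e]
    have l2: "((\<lambda>t. ?U t * ?u (j + 1) t / real (j + 2) + 2 * ?u j t / (- ln t)^2) \<longlongrightarrow> 1 / fact k) (at_right 0)"
      using tendsto_add[OF l1 l0] by simp
    show ?thesis
    proof (rule tendsto_sandwich[OF _ _ l1 l2])
      show "\<forall>\<^sub>F t in at_right 0. ?U t * ?u (j + 1) t / real (j + 2) \<le> ?u k t"
        using ev
      proof eventually_elim
        case (elim t)
        then have l: "(- ln t) ^ k \<ge> 0" by (intro zero_le_power) simp
        have d: "x / real (j + 2) \<le> y" if "x \<le> real (j + 2) * y" for x y :: real
          using that by (simp add: divide_le_eq mult.commute del: of_nat_add)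
        have "?U t * ?u (j + 1) t / real (j + 2) = (dseries Q (1 + t) * dseries (smooth_almost_primes Q (j + 1)) (1 + t) / real (j + 2)) / (- ln t) ^ k"
          using 3 by (simp add: field_simps)
        also have "\<dots> \<le> ?u k t"
          using dseries_almost_primes_lower[OF Q(1), of "1 + t" "j + 1"] elim 3
          by (intro divide_right_mono d l) simp
        finally show ?case .
      qed
      show "\<forall>\<^sub>F t in at_right 0. ?u k t \<le> ?U t * ?u (j + 1) t / real (j + 2) + 2 * ?u j t / (- ln t)^2"
        using ev
      proof eventually_elim
        case (elim t)
        then have l: "- ln t > 0" by simp
        have d: "x \<le> y / real (j + 2) + z" if "real (j + 2) * x \<le> y + real (j + 2) * z" for x y z :: real
        proof -
          have "real (j + 2) * x \<le> real (j + 2) * (y / real (j + 2) + z)"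
            using that by (simp add: distrib_left del: of_nat_add)
          then show ?thesis by (subst (asm) mult_le_cancel_left_pos) auto
        qed
        have "dseries (smooth_almost_primes Q k) (1 + t) \<le> dseries Q (1 + t) * dseries (smooth_almost_primes Q (j + 1)) (1 + t) / real (j + 2)
           + 2 * dseries (smooth_almost_primes Q j) (1 + t)"
          using dseries_almost_primes_upper[OF Q(1), of "1 + t" j] elim 3 by (intro d) simp
        then have "?u k t \<le> (dseries Q (1 + t) * dseries (smooth_almost_primes Q (j + 1)) (1 + t) / real (j + 2)
           + 2 * dseries (smooth_almost_primes Q j) (1 + t)) / (- ln t) ^ k"
          by (rule divide_right_mono[OF _ zero_le_power[OF less_imp_le[OF l]]])
        also have "\<dots> = ?U t * ?u (j + 1) t / real (j + 2) + 2 * ?u j t / (- ln t)^2"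
          using l 3 by (simp add: add_divide_distrib power_add power2_eq_square mult_ac)
        finally show ?case .
      qed
    qed
  qed
qed

section \<open>An Abelian theorem\<close>

text \<open>Taken with b = ln a for the terms of the Dirichlet series, and with b = ln 2 for the
  error term 2 powr -t.\<close>

lemma nn_integral_Gamma_scaled:
  fixes b z :: real
  assumes "b > 0" "z > 0"
  shows "(\<integral>\<^sup>+t. ennreal (indicator {0<..} t * t powr (z - 1) * exp (- b * t)) \<partial>lborel) = ennreal (Gamma z / b powr z)"
    (is "?I = _")
proof -
  have "ennreal (Gamma z) = (\<integral>\<^sup>+t. ennreal (indicator {0..} t * t powr (z - 1) / exp t) \<partial>lborel)"
    by (rule Gamma_conv_nn_integral_real) fact
  also have "\<dots> = \<bar>b\<bar> * (\<integral>\<^sup>+t. ennreal (indicator {0..} (0 + b * t) * (0 + b * t) powr (z - 1) / exp (0 + b * t)) \<partial>lborel)"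
    by (rule nn_integral_real_affine) (use assms in auto)
  also have "(\<integral>\<^sup>+t. ennreal (indicator {0..} (0 + b * t) * (0 + b * t) powr (z - 1) / exp (0 + b * t)) \<partial>lborel)
    = (\<integral>\<^sup>+t. ennreal (b powr (z - 1)) * ennreal (indicator {0<..} t * t powr (z - 1) * exp (- b * t)) \<partial>lborel)"
  proof (rule nn_integral_cong)
    fix t :: real
    have "indicator {0..} (0 + b * t) * (0 + b * t) powr (z - 1) / exp (0 + b * t) =
      b powr (z - 1) * (indicator {0<..} t * t powr (z - 1) * exp (- b * t))"
      using assms by (cases "t > 0") (auto simp: indicator_def powr_mult exp_minus divide_inverse zero_le_mult_iff)
    then show "ennreal (indicator {0..} (0 + b * t) * (0 + b * t) powr (z - 1) / exp (0 + b * t)) =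
      ennreal (b powr (z - 1)) * ennreal (indicator {0<..} t * t powr (z - 1) * exp (- b * t))"
      by (simp add: ennreal_mult')
  qed
  also have "\<dots> = ennreal (b powr (z - 1)) * ?I" by (rule nn_integral_cmult) simp
  finally have "ennreal (Gamma z) = ennreal (b * b powr (z - 1)) * ?I"
    using assms by (simp add: ennreal_mult' mult.assoc)
  also have "b * b powr (z - 1) = b powr z" using assms by (simp add: powr_diff)
  finally have e: "ennreal (Gamma z) = ennreal (b powr z) * ?I" .
  have "?I = ennreal (1 / b powr z) * (ennreal (b powr z) * ?I)"
    using assms by (simp add: mult.assoc[symmetric] ennreal_mult'[symmetric])
  also have "\<dots> = ennreal (Gamma z / b powr z)"
    unfolding e[symmetric] using assms by (simp add: ennreal_mult'[symmetric])
  finally show ?thesis .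
qed

lemma tendsto_powr_times_ln_power:
  fixes z :: real
  assumes "z > 0"
  shows "((\<lambda>t. t powr z * (- ln t) ^ k) \<longlongrightarrow> 0) (at_right 0)"
proof -
  have "filterlim (\<lambda>t::real. z * (- ln t)) at_top (at_right 0)"
    by (rule filterlim_tendsto_pos_mult_at_top[OF tendsto_const assms filterlim_minus_ln_at_right_0])
  from filterlim_compose[OF tendsto_power_div_exp_0 this]
  have "((\<lambda>t. (z * (- ln t)) ^ k / exp (z * (- ln t)) / z ^ k) \<longlongrightarrow> 0 / z ^ k) (at_right 0)"
    using assms by (intro tendsto_divide tendsto_const) auto
  then have "((\<lambda>t. (z * (- ln t)) ^ k / exp (z * (- ln t)) / z ^ k) \<longlongrightarrow> 0) (at_right 0)" by simp
  then show ?thesis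
  proof (rule Lim_transform_eventually)
    show "\<forall>\<^sub>F t in at_right 0. (z * (- ln t)) ^ k / exp (z * (- ln t)) / z ^ k = t powr z * (- ln t) ^ k"
      using eventually_at_right_less[of 0]
    proof eventually_elim
      case (elim t)
      then have "exp (z * (- ln t)) = 1 / t powr z" by (simp add: powr_def exp_minus divide_inverse)
      then show ?case unfolding power_mult_distrib using assms by simp
    qed
  qed
qed

text \<open>Integration by parts: t powr z * (- ln t)^(k + 1) vanishes at both ends, so z times the
  integral for k + 1 equals k + 1 times the integral for k.\<close>

lemma has_integral_powr_ln_power:
  fixes z :: real
  assumes z: "z > 0"
  shows "((\<lambda>t. t powr (z - 1) * (- ln t) ^ k) has_integral (fact k / z ^ (k + 1))) {0..1}"
proof -
  have cont: "continuous_on {0..1} (\<lambda>t. t powr z * (- ln t) ^ k)" for k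
    unfolding continuous_on_eq_continuous_within
  proof
    fix x :: real assume x: "x \<in> {0..1}"
    show "continuous (at x within {0..1}) (\<lambda>t. t powr z * (- ln t) ^ k)"
    proof (cases "x = 0")
      case True
      \<comment> \<open>The value \<open>0 powr z = 0\<close> agrees with the limit, so the
        antiderivative is continuous on the closed interval although the integrand may blow up at
        0.\<close>
      have "((\<lambda>t. t powr z * (- ln t) ^ k) \<longlongrightarrow> 0) (at 0 within {0..1})"
        using tendsto_powr_times_ln_power[OF z, of k] by (simp add: at_within_Icc_at_right)
      then show ?thesis using True z by (simp add: continuous_within)
    next
      case False
      then show ?thesis using x by (intro continuous_intros) auto
    qed
  qed
  show ?thesis
  proof (induction k)
    case 0
    have cont0: "continuous_on {0..1} (\<lambda>t. t powr z / z)"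
      using continuous_on_divide[OF cont[of 0] continuous_on_const[of _ z]] z by simp
    have "((\<lambda>t. t powr (z - 1)) has_integral (1 powr z / z - 0 powr z / z)) {0..1}"
    proof (rule fundamental_theorem_of_calculus_interior)
      show "continuous_on {0..1} (\<lambda>t. t powr z / z)" by (rule cont0)
      fix t :: real assume "t \<in> {0<..<1}"
      then show "((\<lambda>t. t powr z / z) has_vector_derivative t powr (z - 1)) (at t)"
        using z by (auto intro!: derivative_eq_intros simp: has_real_derivative_iff_has_vector_derivative[symmetric])
    qed simp
    then show ?case by simp
  next
    case (Suc k)
    let ?F = "\<lambda>t. t powr z * (- ln t) ^ Suc k"
    have "((\<lambda>t. z * (t powr (z - 1) * (- ln t) ^ Suc k) - real (Suc k) * (t powr (z - 1) * (- ln t) ^ k)) has_integral (?F 1 - ?F 0)) {0..1}"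
    proof (rule fundamental_theorem_of_calculus_interior[OF _ cont])
      fix t :: real assume t: "t \<in> {0<..<1}"
      have "(?F has_real_derivative
          z * t powr (z - 1) * (- ln t) ^ Suc k + t powr z * (real (Suc k) * (- ln t) ^ k * (- (1 / t)))) (at t)"
      proof -
        have d1: "((\<lambda>t. t powr z) has_real_derivative z * t powr (z - 1)) (at t)"
          using t by (auto intro!: derivative_eq_intros)
        have "((\<lambda>t. - ln t) has_real_derivative - (1 / t)) (at t)"
          using t by (auto intro!: derivative_eq_intros)
        then have d2: "((\<lambda>t. (- ln t) ^ Suc k) has_real_derivative real (Suc k) * (- ln t) ^ k * (- (1 / t))) (at t)"
          by (rule DERIV_cong[OF DERIV_power_Suc]) (simp add: mult_ac)
        from DERIV_mult[OF d1 d2] show ?thesis by (simp add: mult_ac add_ac)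
      qed
      moreover have "t powr (z - 1) = t powr z / t" using t by (simp add: powr_diff)
      ultimately have "(?F has_real_derivative
          z * (t powr (z - 1) * (- ln t) ^ Suc k) - real (Suc k) * (t powr (z - 1) * (- ln t) ^ k)) (at t)"
        by (simp add: mult_ac)
      then show "(?F has_vector_derivative
          z * (t powr (z - 1) * (- ln t) ^ Suc k) - real (Suc k) * (t powr (z - 1) * (- ln t) ^ k)) (at t)"
        by (simp only: has_real_derivative_iff_has_vector_derivative)
    qed simp
    from has_integral_add[OF this has_integral_mult_right[OF Suc.IH, of "real (Suc k)"]] z
    have "((\<lambda>t. z * (t powr (z - 1) * (- ln t) ^ Suc k)) has_integral (real (Suc k) * (fact k / z ^ (k + 1)))) {0..1}"
      by simp
    from has_integral_mult_right[OF this, of "1 / z"] z show ?case by (simp add: field_simps)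
  qed
qed

lemma nn_integral_powr_ln_power:
  fixes z :: real
  assumes "z > 0"
  shows "(\<integral>\<^sup>+t. ennreal (indicator {0<..} t * t powr (z - 1) * (indicator {..<1} t * (- ln t) ^ k)) \<partial>lborel)
    = ennreal (fact k / z ^ (k + 1))"
proof -
  have "ennreal (fact k / z ^ (k + 1)) = (\<integral>\<^sup>+t. ennreal (t powr (z - 1) * (- ln t) ^ k) * indicator {0..1} t \<partial>lborel)"
  proof (rule nn_integral_has_integral_lebesgue'[symmetric, OF _ has_integral_powr_ln_power[OF assms]])
    fix t :: real assume "t \<in> {0..1}"
    then have "ln t \<le> 0" by (cases "t = 0") auto
    then show "0 \<le> t powr (z - 1) * (- ln t) ^ k" by (intro mult_nonneg_nonneg zero_le_power) auto
  qed
  also have "\<dots> = (\<integral>\<^sup>+t. ennreal (indicator {0<..} t * t powr (z - 1) * (indicator {..<1} t * (- ln t) ^ k)) \<partial>lborel)"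
  proof (rule nn_integral_cong_AE)
    show "AE t in lborel. ennreal (t powr (z - 1) * (- ln t) ^ k) * indicator {0..1} t =
      ennreal (indicator {0<..} t * t powr (z - 1) * (indicator {..<1} t * (- ln t) ^ k))"
      using AE_lborel_singleton[of 0] AE_lborel_singleton[of 1]
      by eventually_elim (auto simp: indicator_def)
  qed
  finally show ?thesis ..
qed

section \<open>From Dirichlet series to logarithmic series\<close>

lemma infsum_powr_eq_dseries:
  "(\<Sum>\<^sub>\<infinity>a\<in>A. ennreal (indicator {0<..} t * t powr (z - 1) * real a powr (-(1 + t))))
    = ennreal (indicator {0<..} t * t powr (z - 1) * dseries A (1 + t))"
proof (cases "t > 0")
  case True
  then have "(\<Sum>\<^sub>\<infinity>a\<in>A. ennreal (indicator {0<..} t * t powr (z - 1) * real a powr (-(1 + t))))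
    = (\<Sum>\<^sub>\<infinity>a\<in>A. ennreal (t powr (z - 1)) * ennreal (real a powr (-(1 + t))))"
    by (simp add: ennreal_mult')
  also have "\<dots> = ennreal (t powr (z - 1)) * ennreal (dseries A (1 + t))"
    using True by (simp add: infsum_cmult_ennreal ennreal_dseries)
  finally show ?thesis using True by (simp add: ennreal_mult')
qed simp

lemma Gamma_times_log_series:
  fixes z :: real
  assumes A: "A \<subseteq> {2..}" and z: "z > 0"
  shows "ennreal (Gamma z) * (\<Sum>\<^sub>\<infinity>a\<in>A. ennreal (1 / (real a * ln (real a) powr z)))
    = (\<integral>\<^sup>+t. ennreal (indicator {0<..} t * t powr (z - 1) * dseries A (1 + t)) \<partial>lborel)"
proof -
  let ?f = "\<lambda>a t. ennreal (indicator {0<..} t * t powr (z - 1) * real a powr (-(1 + t)))"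
  have G: "Gamma z > 0" using z by (rule Gamma_real_pos)
  have "ennreal (Gamma z) * (\<Sum>\<^sub>\<infinity>a\<in>A. ennreal (1 / (real a * ln (real a) powr z)))
    = (\<Sum>\<^sub>\<infinity>a\<in>A. ennreal (Gamma z) * ennreal (1 / (real a * ln (real a) powr z)))"
    by (simp add: infsum_cmult_ennreal)
  also have "\<dots> = (\<Sum>\<^sub>\<infinity>a\<in>A. \<integral>\<^sup>+t. ?f a t \<partial>lborel)"
  proof (rule infsum_cong)
    fix a assume "a \<in> A"
    then have a: "real a \<ge> 2" using A by auto
    then have l: "ln a > 0" by simp
    have "(\<integral>\<^sup>+t. ?f a t \<partial>lborel) = (\<integral>\<^sup>+t. ennreal (1 / a) * ennreal (indicator {0<..} t * t powr (z - 1) * exp (- ln a * t)) \<partial>lborel)"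
    proof (rule nn_integral_cong)
      fix t :: real
      have "real a powr (-(1 + t)) = 1 / a * exp (- ln a * t)"
        using a by (simp add: powr_def exp_add exp_diff exp_minus field_simps)
      then have "?f a t = ennreal (1 / a * (indicator {0<..} t * t powr (z - 1) * exp (- ln a * t)))"
        by (simp add: mult_ac)
      also have "\<dots> = ennreal (1 / a) * ennreal (indicator {0<..} t * t powr (z - 1) * exp (- ln a * t))"
        by (rule ennreal_mult') simp
      finally show "?f a t = \<dots>" .
    qed
    also have "\<dots> = ennreal (1 / a) * ennreal (Gamma z / ln a powr z)"
      by (subst nn_integral_cmult) (simp_all only: nn_integral_Gamma_scaled[OF l z], measurable)
    also have "\<dots> = ennreal (Gamma z) * ennreal (1 / (real a * ln (real a) powr z))"
      using G a by (simp add: ennreal_mult'[symmetric])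
    finally show "ennreal (Gamma z) * ennreal (1 / (real a * ln (real a) powr z)) = (\<integral>\<^sup>+t. ?f a t \<partial>lborel)" ..
  qed
  also have "\<dots> = (\<integral>\<^sup>+t. (\<Sum>\<^sub>\<infinity>a\<in>A. ?f a t) \<partial>lborel)"
    unfolding infsum_ennreal_eq_nn_integral
    by (rule nn_integral_count_space_nn_integral[symmetric]) auto
  also have "\<dots> = (\<integral>\<^sup>+t. ennreal (indicator {0<..} t * t powr (z - 1) * dseries A (1 + t)) \<partial>lborel)"
    by (intro nn_integral_cong infsum_powr_eq_dseries)
  finally show ?thesis .
qed

text \<open>Measurability is inherited from the termwise expansion, a countable sum of measurable
  functions.\<close>

lemma borel_measurable_dseries:
  "(\<lambda>t. ennreal (indicator {0<..} t * t powr (z - 1) * dseries A (1 + t))) \<in> borel_measurable borel"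
  unfolding infsum_powr_eq_dseries[symmetric] infsum_ennreal_eq_nn_integral
  by (subst nn_integral_count_space_indicator, simp, subst nn_integral_count_space_nat, measurable)

text \<open>Modulo \<open>M * 2 powr -t\<close>, which integrates to something bounded as \<open>z \<rightarrow> 0\<close>, only the behaviour
  of the Dirichlet series at \<open>t \<rightarrow> 0\<close> matters.\<close>

lemma dseries_global_bounds:
  assumes A: "A \<subseteq> {2..}" and c: "c \<ge> 0" and e: "e > 0"
    and lim: "((\<lambda>t. dseries A (1 + t) / (- ln t) ^ k) \<longlongrightarrow> c) (at_right 0)"
  obtains M where "M \<ge> 0"
    and "\<And>t. t > 0 \<Longrightarrow> dseries A (1 + t) \<le> (c + e) * (indicator {..<1} t * (- ln t) ^ k) + M * 2 powr -t"
    and "\<And>t. t > 0 \<Longrightarrow> c * (indicator {..<1} t * (- ln t) ^ k) \<le>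
      dseries A (1 + t) + (e * (indicator {..<1} t * (- ln t) ^ k) + M * 2 powr -t)"
proof -
  have "\<forall>\<^sub>F t in at_right 0. \<bar>dseries A (1 + t) / (- ln t) ^ k - c\<bar> < e"
    using tendstoD[OF lim e] by (simp add: dist_real_def)
  then obtain b where b: "b > 0" "\<And>t. 0 < t \<Longrightarrow> t < b \<Longrightarrow> \<bar>dseries A (1 + t) / (- ln t) ^ k - c\<bar> < e"
    unfolding eventually_at_right_field by auto
  define d where "d = min b (1/2)"
  have d: "0 < d" "d < 1" "d \<le> b" using b by (auto simp: d_def)
  \<comment> \<open>The first summand dominates the Dirichlet series for t \<ge> d: each a is at
    least 2, so a powr -(1 + t) shrinks beyond d at least by the factor 2 powr (d - t), which
    explains the base 2. The second dominates c * (- ln t)^k for d \<le> t < 1; its factor 2 makes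
    up for 2 powr -t \<ge> 1/2 there.\<close>
  define M where "M = dseries A (1 + d) * 2 powr d + c * (- ln d) ^ k * 2"
  have lnd: "(- ln d) ^ k \<ge> 0" using d by (intro zero_le_power) simp
  have M1: "dseries A (1 + d) * 2 powr d \<ge> 0" by (simp add: dseries_nonneg)
  have M2: "c * (- ln d) ^ k * 2 \<ge> 0" using c lnd by simp
  have M: "M \<ge> 0" using M1 M2 by (simp add: M_def)
  have near: "\<bar>dseries A (1 + t) - c * (- ln t) ^ k\<bar> \<le> e * (- ln t) ^ k" if t: "0 < t" "t < d" for t
  proof -
    have l: "(- ln t) ^ k > 0" using t d by (intro zero_less_power) simp
    have "x - c * y = (x / y - c) * y" if "y > 0" for x y :: real
      using that by (simp add: left_diff_distrib)
    from this[OF l, of "dseries A (1 + t)"]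
    have "\<bar>dseries A (1 + t) - c * (- ln t) ^ k\<bar> = \<bar>(dseries A (1 + t) / (- ln t) ^ k - c) * (- ln t) ^ k\<bar>"
      by (rule arg_cong)
    also have "\<dots> = \<bar>dseries A (1 + t) / (- ln t) ^ k - c\<bar> * (- ln t) ^ k" 
      using l by (simp only: abs_mult abs_of_pos)
    also have "\<dots> \<le> e * (- ln t) ^ k"
      using b(2)[of t] t d l by (intro mult_right_mono) auto
    finally show ?thesis .
  qed
  have far1: "dseries A (1 + t) \<le> M * 2 powr -t" if t: "t \<ge> d" for t
  proof -
    have "dseries A (1 + t) \<le> (\<Sum>\<^sub>\<infinity>a\<in>A. real a powr (-(1 + d)) * 2 powr (d - t))"
      unfolding dseries_def
    proof (intro infsum_mono summable_on_powr summable_on_cmult_left)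
      fix a assume "a \<in> A"
      then have a: "real a \<ge> 2" using A by auto
      have "real a powr (-(1 + t)) = real a powr (-(1 + d)) * real a powr (d - t)"
        by (simp add: powr_add[symmetric])
      also have "\<dots> \<le> real a powr (-(1 + d)) * 2 powr (d - t)"
        using a t by (intro mult_left_mono powr_mono2') auto
      finally show "real a powr (-(1 + t)) \<le> real a powr (-(1 + d)) * 2 powr (d - t)" .
    qed (use d t in auto)
    also have "\<dots> = dseries A (1 + d) * 2 powr (d - t)"
      unfolding dseries_def by (rule infsum_cmult_left')
    also have "\<dots> = dseries A (1 + d) * 2 powr d * 2 powr -t"
      by (simp add: powr_diff powr_minus divide_inverse)
    also have "\<dots> \<le> M * 2 powr -t"
      using M2 by (intro mult_right_mono) (auto simp: M_def)
    finally show ?thesis .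
  qed
  have far2: "c * (- ln t) ^ k \<le> M * 2 powr -t" if t: "t \<ge> d" "t < 1" for t
  proof -
    have "(- ln t) ^ k \<le> (- ln d) ^ k" using t d by (intro power_mono) auto
    then have "c * (- ln t) ^ k \<le> (c * (- ln d) ^ k * 2) * (1/2)" using c by (simp add: mult_left_mono)
    also have "\<dots> \<le> M * 2 powr -t"
    proof (rule mult_mono)
      have "2 powr -1 \<le> (2::real) powr -t" using t by (intro powr_mono) auto
      then show "1/2 \<le> (2::real) powr -t" by (simp add: powr_minus_divide)
      show "c * (- ln d) ^ k * 2 \<le> M" using M1 by (simp add: M_def)
    qed (use M in auto)
    finally show ?thesis .
  qed
  show ?thesis
  proof (rule that[OF M])
    fix t :: real assume t: "t > 0"
    let ?L = "indicator {..<1} t * (- ln t) ^ k"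
    have L: "?L \<ge> 0" using t by (auto simp: indicator_def intro!: zero_le_power)
    have E: "M * 2 powr -t \<ge> 0" using M by simp
    have cL: "c * ?L \<ge> 0" "e * ?L \<ge> 0" using c e L by simp_all
    have D: "dseries A (1 + t) \<ge> 0" by (rule dseries_nonneg)
    have "dseries A (1 + t) \<le> c * ?L + e * ?L + M * 2 powr -t \<and> c * ?L \<le> dseries A (1 + t) + (e * ?L + M * 2 powr -t)"
    proof (cases "t < d")
      case True
      then have L': "?L = (- ln t) ^ k" using d by simp
      show ?thesis unfolding L' using near[OF t True] E by (intro conjI; linarith)
    next
      case False
      have "c * ?L \<le> M * 2 powr -t"
        using far2[of t] False E by (cases "t < 1") auto
      then show ?thesis using far1[of t] False cL D by (intro conjI; linarith)
    qed
    then show "dseries A (1 + t) \<le> (c + e) * ?L + M * 2 powr -t"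
      and "c * ?L \<le> dseries A (1 + t) + (e * ?L + M * 2 powr -t)"
      by (simp_all only: distrib_right)
  qed
qed

text \<open>The pointwise bounds are integrated against t powr (z - 1) and multiplied by z^k / Gamma
  z. The logarithmic term becomes k! / Gamma (1 + z) by z * Gamma z = Gamma (1 + z), and 2 powr -t
  becomes z^k / (ln 2) powr z, which tends to 0 for k \<ge> 1. In the lower bound the error stands
  on the larger side, so that no subtraction in \<open>ennreal\<close> arises.\<close>

lemma abelian_log_series_bounds:
  fixes A :: "nat set" and z :: real
  defines "H \<equiv> \<lambda>z. \<Sum>\<^sub>\<infinity>a\<in>A. ennreal (1 / (real a * ln (real a) powr z))"
  assumes A: "A \<subseteq> {2..}" and c: "c \<ge> 0" and e: "e > 0" and M: "M \<ge> 0" and z: "z > 0"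
    and up: "\<And>t. t > 0 \<Longrightarrow> dseries A (1 + t) \<le> (c + e) * (indicator {..<1} t * (- ln t) ^ k) + M * 2 powr -t"
    and low: "\<And>t. t > 0 \<Longrightarrow> c * (indicator {..<1} t * (- ln t) ^ k) \<le>
      dseries A (1 + t) + (e * (indicator {..<1} t * (- ln t) ^ k) + M * 2 powr -t)"
  shows "H z \<noteq> top"
    and "\<bar>z ^ k * enn2real (H z) - c * fact k / Gamma (1 + z)\<bar> \<le> e * fact k / Gamma (1 + z) + M * z ^ k / ln 2 powr z"
proof -
  let ?w = "\<lambda>t. indicator {0<..} t * t powr (z - 1)"
  let ?L = "\<lambda>t. indicator {..<1} t * (- ln t) ^ k"
  let ?D = "\<lambda>t. dseries A (1 + t)"
  have G: "Gamma z > 0" using z by (rule Gamma_real_pos)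
  have L: "?L t \<ge> 0" if "t > 0" for t :: real using that by (auto simp: indicator_def intro!: zero_le_power)
  have iL: "(\<integral>\<^sup>+t. ennreal (?w t * ?L t) \<partial>lborel) = ennreal (fact k / z ^ (k + 1))"
    by (rule nn_integral_powr_ln_power[OF z])
  have iE: "(\<integral>\<^sup>+t. ennreal (?w t * 2 powr -t) \<partial>lborel) = ennreal (Gamma z / ln 2 powr z)"
    using nn_integral_Gamma_scaled[of "ln 2" z] z by (simp add: powr_def mult.commute)
  have iD: "(\<integral>\<^sup>+t. ennreal (?w t * ?D t) \<partial>lborel) = ennreal (Gamma z) * H z"
    unfolding H_def by (rule Gamma_times_log_series[OF A z, symmetric])
  note [measurable] = borel_measurable_dseries[of z A]
  have mix: "(\<integral>\<^sup>+t. ennreal (?w t * (a * ?L t + b * 2 powr -t)) \<partial>lborel) = ennreal (a * (fact k / z ^ (k + 1)) + b * (Gamma z / ln 2 powr z))"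
    if ab: "a \<ge> 0" "b \<ge> 0" for a b
  proof -
    have "(\<integral>\<^sup>+t. ennreal (?w t * (a * ?L t + b * 2 powr -t)) \<partial>lborel)
      = (\<integral>\<^sup>+t. ennreal a * ennreal (?w t * ?L t) + ennreal b * ennreal (?w t * 2 powr -t) \<partial>lborel)"
    proof (rule nn_integral_cong)
      fix t :: real
      show "ennreal (?w t * (a * ?L t + b * 2 powr -t)) = ennreal a * ennreal (?w t * ?L t) + ennreal b * ennreal (?w t * 2 powr -t)"
      proof (cases "t > 0")
        case True
        have "?w t * (a * ?L t + b * 2 powr -t) = a * (?w t * ?L t) + b * (?w t * 2 powr -t)"
          by (simp add: algebra_simps)
        then show ?thesis using ab L[OF True] by (simp add: ennreal_plus ennreal_mult)
      qed simp
    qed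
    also have "\<dots> = ennreal a * ennreal (fact k / z ^ (k + 1)) + ennreal b * ennreal (Gamma z / ln 2 powr z)"
      by (subst nn_integral_add) (auto simp: nn_integral_cmult iL iE)
    also have "\<dots> = ennreal (a * (fact k / z ^ (k + 1)) + b * (Gamma z / ln 2 powr z))"
    proof -
      have "ennreal a * ennreal x + ennreal b * ennreal y = ennreal (a * x + b * y)" if "x \<ge> 0" "y \<ge> 0" for x y
        using ab that by (simp add: ennreal_plus ennreal_mult)
      then show ?thesis using z G by simp
    qed
    finally show ?thesis .
  qed
  have "ennreal (Gamma z) * H z \<le> (\<integral>\<^sup>+t. ennreal (?w t * ((c + e) * ?L t + M * 2 powr -t)) \<partial>lborel)"
    unfolding iD[symmetric]
  proof (intro nn_integral_mono ennreal_leI)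
    fix t :: real
    show "?w t * ?D t \<le> ?w t * ((c + e) * ?L t + M * 2 powr -t)"
      using up[of t] by (cases "t > 0") (auto intro: mult_left_mono)
  qed
  also have "\<dots> = ennreal ((c + e) * (fact k / z ^ (k + 1)) + M * (Gamma z / ln 2 powr z))"
    by (rule mix) (use c e M in auto)
  finally have u: "ennreal (Gamma z) * H z \<le> ennreal ((c + e) * (fact k / z ^ (k + 1)) + M * (Gamma z / ln 2 powr z))" .
  show fin: "H z \<noteq> top"
  proof
    assume "H z = top"
    with u G show False by (simp add: ennreal_mult_top top_unique)
  qed
  define h where "h = enn2real (H z)"
  have h: "H z = ennreal h" "h \<ge> 0" using fin by (auto simp: h_def less_top)
  have "ennreal (Gamma z * h) \<le> ennreal ((c + e) * (fact k / z ^ (k + 1)) + M * (Gamma z / ln 2 powr z))"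
    using u unfolding h(1) ennreal_mult'[OF less_imp_le[OF G]] .
  moreover have "0 \<le> (c + e) * (fact k / z ^ (k + 1)) + M * (Gamma z / ln 2 powr z)"
    using c e M z G by (intro add_nonneg_nonneg mult_nonneg_nonneg) auto
  ultimately have u': "Gamma z * h \<le> (c + e) * (fact k / z ^ (k + 1)) + M * (Gamma z / ln 2 powr z)"
    by (simp only: ennreal_le_iff)
  have nn: "0 \<le> Gamma z * h" "0 \<le> e * (fact k / z ^ (k + 1)) + M * (Gamma z / ln 2 powr z)"
    using e M z G h(2) by (auto intro!: add_nonneg_nonneg mult_nonneg_nonneg divide_nonneg_nonneg)
  have "ennreal (c * (fact k / z ^ (k + 1))) = (\<integral>\<^sup>+t. ennreal (?w t * (c * ?L t + 0 * 2 powr -t)) \<partial>lborel)"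
    by (subst mix) (use c in auto)
  also have "\<dots> \<le> (\<integral>\<^sup>+t. ennreal (?w t * ?D t) + ennreal (?w t * (e * ?L t + M * 2 powr -t)) \<partial>lborel)"
  proof (intro nn_integral_mono)
    fix t :: real
    show "ennreal (?w t * (c * ?L t + 0 * 2 powr -t)) \<le> ennreal (?w t * ?D t) + ennreal (?w t * (e * ?L t + M * 2 powr -t))"
    proof (cases "t > 0")
      case True
      have nn: "?w t * ?D t \<ge> 0" "?w t * (e * ?L t + M * 2 powr -t) \<ge> 0"
        using L[OF True] e M by (auto intro!: mult_nonneg_nonneg add_nonneg_nonneg dseries_nonneg)
      have "?w t * (c * ?L t + 0 * 2 powr -t) \<le> ?w t * (?D t + (e * ?L t + M * 2 powr -t))"
        using low[OF True] by (intro mult_left_mono) auto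
      then show ?thesis unfolding ennreal_plus[OF nn, symmetric] by (intro ennreal_leI) (simp only: distrib_left)
    qed simp
  qed
  also have "\<dots> = ennreal (Gamma z) * H z + ennreal (e * (fact k / z ^ (k + 1)) + M * (Gamma z / ln 2 powr z))"
    using e M by (subst nn_integral_add) (auto simp: iD mix)
  also have "\<dots> = ennreal (Gamma z * h + (e * (fact k / z ^ (k + 1)) + M * (Gamma z / ln 2 powr z)))"
    unfolding h(1) ennreal_mult'[OF less_imp_le[OF G], symmetric] using nn by (simp only: ennreal_plus)
  finally have l': "c * (fact k / z ^ (k + 1)) \<le> Gamma z * h + (e * (fact k / z ^ (k + 1)) + M * (Gamma z / ln 2 powr z))"
    using nn by (simp only: ennreal_le_iff add_nonneg_nonneg)
  have "z \<notin> \<int>\<^sub>\<le>\<^sub>0" using z nonpos_Ints_nonpos[of z] by linarith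
  then have g: "Gamma (1 + z) = z * Gamma z" using Gamma_plus1[of z] by (simp add: add.commute)
  define r where "r = z ^ k / Gamma z"
  have r: "r \<ge> 0" using z G by (simp add: r_def)
  have r1: "r * (Gamma z * h) = z ^ k * h" using G by (simp add: r_def)
  have r2: "r * (x * (fact k / z ^ (k + 1))) = x * fact k / Gamma (1 + z)" for x
    using z G by (simp add: r_def g field_simps)
  have r3: "r * (M * (Gamma z / ln 2 powr z)) = M * z ^ k / ln 2 powr z"
    using G by (simp add: r_def)
  have "z ^ k * h \<le> (c + e) * fact k / Gamma (1 + z) + M * z ^ k / ln 2 powr z"
    using mult_left_mono[OF u' r] by (simp only: distrib_left r1 r2 r3)
  moreover have "c * fact k / Gamma (1 + z) \<le> z ^ k * h + (e * fact k / Gamma (1 + z) + M * z ^ k / ln 2 powr z)"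
    using mult_left_mono[OF l' r] by (simp only: distrib_left r1 r2 r3)
  ultimately show "\<bar>z ^ k * enn2real (H z) - c * fact k / Gamma (1 + z)\<bar> \<le> e * fact k / Gamma (1 + z) + M * z ^ k / ln 2 powr z"
    unfolding h_def[symmetric] by (simp add: add_divide_distrib distrib_right abs_le_iff)
qed

lemma abelian_log_series:
  assumes A: "A \<subseteq> {2..}" and k: "k \<ge> 1"
    and lim: "((\<lambda>t. dseries A (1 + t) / (- ln t) ^ k) \<longlongrightarrow> c) (at_right 0)"
  shows "((\<lambda>z. ennreal (z ^ k) * (\<Sum>\<^sub>\<infinity>a\<in>A. ennreal (1 / (real a * ln (real a) powr z)))) \<longlongrightarrow> ennreal (c * fact k)) (at_right 0)"
proof -
  define H where "H = (\<lambda>z. \<Sum>\<^sub>\<infinity>a\<in>A. ennreal (1 / (real a * ln (real a) powr z)))"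
  have pos: "\<forall>\<^sub>F z::real in at_right 0. 0 < z" by (rule eventually_at_right_less)
  have c: "c \<ge> 0"
  proof (rule tendsto_lowerbound[OF lim])
    have "\<forall>\<^sub>F t::real in at_right 0. 0 < t \<and> t < 1"
      unfolding eventually_at_right_field by (intro exI[of _ 1]) auto
    then show "\<forall>\<^sub>F t in at_right 0. 0 \<le> dseries A (1 + t) / (- ln t) ^ k"
      by eventually_elim (auto intro!: divide_nonneg_nonneg dseries_nonneg zero_le_power)
  qed simp
  have id: "((\<lambda>z::real. z) \<longlongrightarrow> 0) (at_right 0)" by (rule tendsto_ident_at)
  have zk: "((\<lambda>z::real. z ^ k) \<longlongrightarrow> 0) (at_right 0)"
    using tendsto_power[OF id, of k] k by (simp add: power_0_left)
  have "((\<lambda>z::real. Gamma (1 + z)) \<longlongrightarrow> Gamma (1 + 0)) (at_right 0)"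
    by (intro tendsto_Gamma tendsto_intros id) auto
  then have Gam: "((\<lambda>z::real. Gamma (1 + z)) \<longlongrightarrow> 1) (at_right 0)" by simp
  have E: "((\<lambda>z::real. M * z ^ k / ln 2 powr z) \<longlongrightarrow> 0) (at_right 0)" for M
  proof -
    have "((\<lambda>z::real. M * z ^ k / ln 2 powr z) \<longlongrightarrow> M * 0 / ln 2 powr 0) (at_right 0)"
      by (intro tendsto_intros zk id) auto
    then show ?thesis by simp
  qed
  have diff: "((\<lambda>z. z ^ k * enn2real (H z) - c * fact k / Gamma (1 + z)) \<longlongrightarrow> 0) (at_right 0)"
  proof (rule tendstoI)
    fix e :: real assume e: "e > 0"
    \<comment> \<open>As Gamma (1 + z) tends to 1, the error bound tends to e' * k!, which this
      choice makes e / 2.\<close>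
    define e' where "e' = e / (2 * fact k)"
    have e': "e' > 0" "e' * fact k < e" using e by (auto simp: e'_def)
    obtain M where M: "M \<ge> 0"
      "\<And>t. t > 0 \<Longrightarrow> dseries A (1 + t) \<le> (c + e') * (indicator {..<1} t * (- ln t) ^ k) + M * 2 powr -t"
      "\<And>t. t > 0 \<Longrightarrow> c * (indicator {..<1} t * (- ln t) ^ k) \<le>
        dseries A (1 + t) + (e' * (indicator {..<1} t * (- ln t) ^ k) + M * 2 powr -t)"
      using dseries_global_bounds[OF A c e'(1) lim] by blast
    have "((\<lambda>z. e' * fact k / Gamma (1 + z) + M * z ^ k / ln 2 powr z) \<longlongrightarrow> e' * fact k / 1 + 0) (at_right 0)"
      by (intro tendsto_intros Gam E) auto
    then have "\<forall>\<^sub>F z in at_right 0. e' * fact k / Gamma (1 + z) + M * z ^ k / ln 2 powr z < e"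
      by (rule order_tendstoD) (use e' in simp)
    then show "\<forall>\<^sub>F z in at_right 0. dist (z ^ k * enn2real (H z) - c * fact k / Gamma (1 + z)) 0 < e"
      using pos
    proof eventually_elim
      case (elim z)
      then show ?case
        using abelian_log_series_bounds(2)[OF A c e'(1) M(1) elim(2) M(2,3)]
        unfolding H_def by (simp add: dist_real_def)
    qed
  qed
  have "((\<lambda>z. c * fact k / Gamma (1 + z)) \<longlongrightarrow> c * fact k / 1) (at_right 0)"
    by (intro tendsto_intros Gam) auto
  from tendsto_add[OF diff this] have "((\<lambda>z. z ^ k * enn2real (H z)) \<longlongrightarrow> c * fact k) (at_right 0)"
    by simp
  then have "((\<lambda>z. ennreal (z ^ k * enn2real (H z))) \<longlongrightarrow> ennreal (c * fact k)) (at_right 0)"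
    by (rule tendsto_ennrealI)
  then show ?thesis
  proof (rule Lim_transform_eventually)
    \<comment> \<open>Error 1 is good enough here: only finiteness of \<open>H z\<close> is wanted,
      so that \<open>enn2real\<close> can be undone.\<close>
    obtain M where M: "M \<ge> 0"
      "\<And>t. t > 0 \<Longrightarrow> dseries A (1 + t) \<le> (c + 1) * (indicator {..<1} t * (- ln t) ^ k) + M * 2 powr -t"
      "\<And>t. t > 0 \<Longrightarrow> c * (indicator {..<1} t * (- ln t) ^ k) \<le>
        dseries A (1 + t) + (1 * (indicator {..<1} t * (- ln t) ^ k) + M * 2 powr -t)"
      using dseries_global_bounds[OF A c zero_less_one lim] by blast
    show "\<forall>\<^sub>F z in at_right 0. ennreal (z ^ k * enn2real (H z)) =
      ennreal (z ^ k) * (\<Sum>\<^sub>\<infinity>a\<in>A. ennreal (1 / (real a * ln (real a) powr z)))"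
      using pos
    proof eventually_elim
      case (elim z)
      have "H z \<noteq> top"
        unfolding H_def by (rule abelian_log_series_bounds(1)[OF A c zero_less_one M(1) elim M(2,3)])
      then have "ennreal (z ^ k * enn2real (H z)) = ennreal (z ^ k) * H z"
        using elim by (simp add: ennreal_mult' less_top)
      then show ?case by (simp only: H_def)
    qed
  qed
qed

section \<open>Primitive density\<close>

lemma has_primitive_density_of_tendsto:
  assumes "A \<noteq> {1}" "((\<lambda>z. f_sum z A) \<longlongrightarrow> d) (at_right 0)"
  shows "has_primitive_density A d"
  using assms lim_imp_Liminf[OF _ assms(2)] lim_imp_Limsup[OF _ assms(2)]
  by (simp add: has_primitive_density_def lower_eta_def upper_eta_def)

lemma has_primitive_density_one: "has_primitive_density {1} 1"
  by (simp add: has_primitive_density_def lower_eta_def upper_eta_def)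

lemma almost_primes_subset: "k \<ge> 1 \<Longrightarrow> almost_primes k \<subseteq> {2..}"
proof
  fix n assume "k \<ge> 1" "n \<in> almost_primes k"
  then have "n \<ge> 1" "n \<noteq> 1" by (auto simp: almost_primes_def)
  then show "n \<in> {2..}" by simp
qed

text \<open>On \<open>almost_primes k\<close> the numerator z^Omega(a) is the constant z^k, exactly
  the normalisation of the Abelian theorem.\<close>

lemma f_sum_tendsto_of_dseries_asymp:
  assumes A: "A \<subseteq> almost_primes k" and k: "k \<ge> 1"
    and lim: "((\<lambda>t. dseries A (1 + t) / (- ln t) ^ k) \<longlongrightarrow> c) (at_right 0)"
  shows "((\<lambda>z. f_sum z A) \<longlongrightarrow> ennreal (c * fact k)) (at_right 0)"
proof -
  have A2: "A \<subseteq> {2..}" using A almost_primes_subset[OF k] by blast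
  show ?thesis
  proof (rule Lim_transform_eventually[OF abelian_log_series[OF A2 k lim]])
    have pos: "\<forall>\<^sub>F z::real in at_right 0. 0 < z" by (rule eventually_at_right_less)
    then show "\<forall>\<^sub>F z in at_right 0.
      ennreal (z ^ k) * (\<Sum>\<^sub>\<infinity>a\<in>A. ennreal (1 / (real a * ln (real a) powr z))) = f_sum z A"
    proof eventually_elim
      case (elim z)
      have "f_sum z A = (\<Sum>\<^sub>\<infinity>a\<in>A. ennreal (z ^ k) * ennreal (1 / (real a * ln (real a) powr z)))"
        unfolding f_sum_def
      proof (rule infsum_cong)
        fix a assume "a \<in> A"
        then have "prime_Omega a = k" using A by (auto simp: almost_primes_def)
        then show "ennreal (z ^ prime_Omega a / (real a * ln (real a) powr z)) =
          ennreal (z ^ k) * ennreal (1 / (real a * ln (real a) powr z))"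
          using elim by (simp add: ennreal_mult'[symmetric])
      qed
      then show ?case by (simp add: infsum_cmult_ennreal)
    qed
  qed
qed

lemma f_sum_smooth_almost_primes_tendsto:
  assumes Q: "Q \<subseteq> {p. prime p}" "finite ({p. prime p} - Q)" and k: "k \<ge> 1"
  shows "((\<lambda>z. f_sum z (smooth_almost_primes Q k)) \<longlongrightarrow> 1) (at_right 0)"
proof -
  have "smooth_almost_primes Q k \<subseteq> almost_primes k"
    by (auto simp: smooth_almost_primes_def smooth_numbers_def almost_primes_def)
  from f_sum_tendsto_of_dseries_asymp[OF this k dseries_smooth_almost_primes_asymp[OF Q]]
  show ?thesis by simp
qed

lemma almost_primes_0: "almost_primes 0 = {1}"
  using smooth_almost_primes_0 smooth_almost_primes_primes by metis

lemma has_primitive_density_almost_primes: "has_primitive_density (almost_primes k) 1"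
proof (cases "k = 0")
  case True
  then show ?thesis using has_primitive_density_one almost_primes_0 by simp
next
  case False
  then have k: "k \<ge> 1" by simp
  have "((\<lambda>z. f_sum z (almost_primes k)) \<longlongrightarrow> 1) (at_right 0)"
    using f_sum_smooth_almost_primes_tendsto[of "{p. prime p}" k] k
    by (simp add: smooth_almost_primes_primes)
  moreover have "almost_primes k \<noteq> {1}" using almost_primes_subset[OF k] by auto
  ultimately show ?thesis by (intro has_primitive_density_of_tendsto)
qed

lemma has_primitive_density_of_dirichlet_density:
  assumes A: "A \<subseteq> almost_primes k"
    and lim: "((\<lambda>s. (\<Sum>\<^sub>\<infinity>a\<in>A. real a powr (- s)) / (\<Sum>\<^sub>\<infinity>m\<in>almost_primes k. real m powr (- s))) \<longlongrightarrow> c) (at_right 1)"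
  shows "has_primitive_density A (ennreal c)"
proof (cases "k = 0")
  \<comment> \<open>Now A is {} or {1}. The summand of \<open>f_sum\<close> at 1 is 0, so the second
    possibility rests on the convention for {1}.\<close>
  case True
  then consider "A = {}" | "A = {1}" using A by (auto simp: almost_primes_0)
  then show ?thesis
  proof cases
    case 1
    have "((\<lambda>s::real. 0) \<longlongrightarrow> c) (at_right 1)" using lim unfolding 1 by simp
    then have "c = 0" using tendsto_unique[OF _ tendsto_const] by (metis trivial_limit_at_right_real)
    moreover have "has_primitive_density {} 0"
      by (rule has_primitive_density_of_tendsto) (auto simp: f_sum_def)
    ultimately show ?thesis using 1 by simp
  next
    case 2
    then have "((\<lambda>s::real. 1) \<longlongrightarrow> c) (at_right 1)" using lim True by (simp add: almost_primes_0[simplified])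
    then have "c = 1" using tendsto_unique[OF _ tendsto_const] by (metis trivial_limit_at_right_real)
    then show ?thesis using 2 has_primitive_density_one by simp
  qed
next
  case False
  then have k: "k \<ge> 1" by simp
  have R: "((\<lambda>t. dseries A (1 + t) / dseries (almost_primes k) (1 + t)) \<longlongrightarrow> c) (at_right 0)"
    using lim unfolding filterlim_at_right_to_0[of _ _ 1] dseries_def by (simp add: add.commute)
  have P: "((\<lambda>t. dseries (almost_primes k) (1 + t) / (- ln t) ^ k) \<longlongrightarrow> 1 / fact k) (at_right 0)"
    using dseries_smooth_almost_primes_asymp[of "{p. prime p}" k] by (simp add: smooth_almost_primes_primes)
  have pos: "\<forall>\<^sub>F t::real in at_right 0. 0 < t" by (rule eventually_at_right_less)
  have "((\<lambda>t. dseries A (1 + t) / (- ln t) ^ k) \<longlongrightarrow> c * (1 / fact k)) (at_right 0)"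
  proof (rule Lim_transform_eventually[OF tendsto_mult[OF R P]])
    show "\<forall>\<^sub>F t in at_right 0. dseries A (1 + t) / dseries (almost_primes k) (1 + t) *
        (dseries (almost_primes k) (1 + t) / (- ln t) ^ k) = dseries A (1 + t) / (- ln t) ^ k"
      using pos
    proof eventually_elim
      case (elim t)
      \<comment> \<open>Cancelling is safe even where the denominator is 0, since by monotonicity
        the numerator is 0 too.\<close>
      have "dseries A (1 + t) = 0" if "dseries (almost_primes k) (1 + t) = 0"
        using dseries_mono[of "1 + t" A "almost_primes k"] A elim that dseries_nonneg[of A "1 + t"] by simp
      then show ?case by auto
    qed
  qed
  from f_sum_tendsto_of_dseries_asymp[OF A k this]
  have "((\<lambda>z. f_sum z A) \<longlongrightarrow> ennreal c) (at_right 0)" by simp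
  moreover have "A \<noteq> {1}" using A almost_primes_subset[OF k] by auto
  ultimately show ?thesis by (intro has_primitive_density_of_tendsto)
qed

section \<open>The bound on the upper density, and negligible sets\<close>

lemma tendsto_ennreal_exp: "((\<lambda>z. ennreal (exp (18 * z))) \<longlongrightarrow> 1) (at_right 0)"
proof -
  have "((\<lambda>z::real. exp (18 * z)) \<longlongrightarrow> exp (18 * 0)) (at_right 0)"
    by (intro tendsto_intros tendsto_ident_at)
  from tendsto_ennrealI[OF this] show ?thesis by simp
qed

lemma eventually_at_right_0_le_1: "\<forall>\<^sub>F z::real in at_right 0. 0 < z \<and> z \<le> 1"
  unfolding eventually_at_right_field by (intro exI[of _ 1]) auto

lemma primitive_set_cases:
  assumes "primitive_set A"
  shows "A = {1} \<or> A \<subseteq> {2..}"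
proof (cases "1 \<in> A")
  case True
  then have "a = 1" if "a \<in> A" for a
    using assms that unfolding primitive_set_def by (metis one_dvd)
  with True show ?thesis by blast
next
  case False
  have "a \<ge> 2" if "a \<in> A" for a
  proof -
    have "a \<ge> 1" using assms that unfolding primitive_set_def by auto
    moreover have "a \<noteq> 1" using that False by metis
    ultimately show ?thesis by simp
  qed
  then show ?thesis by auto
qed

lemma upper_eta_primitive_le_1:
  assumes "primitive_set A"
  shows "upper_eta A \<le> 1"
proof (cases "A = {1}")
  case False
  then have A: "A \<subseteq> {2..}" using primitive_set_cases[OF assms] by blast
  have "Limsup (at_right 0) (\<lambda>z. f_sum z A) \<le> Limsup (at_right 0) (\<lambda>z. ennreal (exp (18 * z)))"
  proof (rule Limsup_mono)
    show "\<forall>\<^sub>F z in at_right 0. f_sum z A \<le> ennreal (exp (18 * z))"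
      using eventually_at_right_0_le_1 by eventually_elim (use f_sum_primitive_le[OF A assms] in auto)
  qed
  also have "\<dots> = 1" by (rule lim_imp_Limsup[OF _ tendsto_ennreal_exp]) simp
  finally show ?thesis using False by (simp add: upper_eta_def)
qed (simp add: upper_eta_def)

lemma lower_eta_le_upper_eta: "lower_eta A \<le> upper_eta A"
  by (simp add: lower_eta_def upper_eta_def Liminf_le_Limsup)

lemma f_sum_mono: "A \<subseteq> B \<Longrightarrow> f_sum z A \<le> f_sum z B"
  unfolding f_sum_def by (rule infsum_mono_ennreal) auto

lemma f_sum_Un_le: "f_sum z (A \<union> B) \<le> f_sum z A + f_sum z B"
proof -
  have "f_sum z (A \<union> B) = f_sum z (A \<union> (B - A))" by simp
  also have "\<dots> = f_sum z A + f_sum z (B - A)"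
    unfolding f_sum_def by (rule infsum_Un_disjoint) auto
  also have "\<dots> \<le> f_sum z A + f_sum z B" by (intro add_left_mono f_sum_mono) auto
  finally show ?thesis .
qed

text \<open>Every a \<ge> 2 has a prime factor, so z^Omega(a) tends to 0 while (ln a) powr z tends
  to 1. Being able to discard finite sets is what yields infinitely many disjoint chains.\<close>

lemma f_sum_finite_tendsto_0:
  assumes "finite F" "F \<subseteq> {2..}"
  shows "((\<lambda>z. f_sum z F) \<longlongrightarrow> 0) (at_right 0)"
proof -
  have "((\<lambda>z::real. z ^ prime_Omega a / (real a * ln (real a) powr z)) \<longlongrightarrow> 0) (at_right 0)" if "a \<in> F" for a
  proof -
    have a: "real a \<ge> 2" using that assms by auto
    then have l: "ln (real a) > 0" by simp
    have "prime_Omega a \<noteq> 0" using prime_Omega_eq_0_iff[of a] a by auto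
    moreover have "((\<lambda>z::real. z ^ prime_Omega a / (real a * ln (real a) powr z)) \<longlongrightarrow>
        0 ^ prime_Omega a / (real a * ln (real a) powr 0)) (at_right 0)"
      using a l by (intro tendsto_intros tendsto_ident_at) auto
    ultimately show ?thesis by (simp add: power_0_left)
  qed
  then have "((\<lambda>z. \<Sum>a\<in>F. ennreal (z ^ prime_Omega a / (real a * ln (real a) powr z))) \<longlongrightarrow> (\<Sum>a\<in>F. ennreal 0)) (at_right 0)"
    by (intro tendsto_sum tendsto_ennrealI)
  then show ?thesis using assms by (simp add: f_sum_def)
qed

section \<open>Divisibility chains\<close>

definition minimal_part :: "nat set \<Rightarrow> nat set" where
  "minimal_part S = {b \<in> S. \<forall>b'\<in>S. b' dvd b \<longrightarrow> b' = b}"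

primrec peel :: "nat set \<Rightarrow> nat \<Rightarrow> nat set" where
  "peel S 0 = S"
| "peel S (Suc m) = peel S m - minimal_part (peel S m)"

lemma peel_subset: "peel S m \<subseteq> S"
  by (induction m) auto

lemma f_sum_le_peel:
  assumes "S \<subseteq> {2..}" "0 < z" "z \<le> 1"
  shows "f_sum z S \<le> of_nat m * ennreal (exp (18 * z)) + f_sum z (peel S m)"
proof (induction m)
  case (Suc m)
  let ?M = "minimal_part (peel S m)"
  have M: "?M \<subseteq> peel S m" by (auto simp: minimal_part_def)
  have M2: "?M \<subseteq> {2..}" using M peel_subset[of S m] assms by blast
  have prim: "primitive_set ?M"
    unfolding primitive_set_def
  proof
    show "?M \<subseteq> {1..}" using M2 by auto
  qed (auto simp: minimal_part_def)
  have "f_sum z (peel S m) = f_sum z (?M \<union> peel S (Suc m))" using M by (simp add: Un_absorb1)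
  also have "\<dots> \<le> ennreal (exp (18 * z)) + f_sum z (peel S (Suc m))"
    using f_sum_Un_le[of z ?M "peel S (Suc m)"] f_sum_primitive_le[OF M2 prim assms(2,3)]
    by (meson add_right_mono order_trans)
  finally have "f_sum z S \<le> of_nat m * ennreal (exp (18 * z)) + (ennreal (exp (18 * z)) + f_sum z (peel S (Suc m)))"
    using Suc.IH by (meson add_left_mono order_trans)
  also have "\<dots> = of_nat (Suc m) * ennreal (exp (18 * z)) + f_sum z (peel S (Suc m))"
    by (simp only: of_nat_Suc distrib_right mult_1_left add_ac)
  finally show ?case .
qed simp

definition dvd_chain :: "nat set \<Rightarrow> nat \<Rightarrow> (nat \<Rightarrow> nat) \<Rightarrow> bool" where
  "dvd_chain S n c \<longleftrightarrow> c ` {1..n} \<subseteq> S \<and> (\<forall>i\<in>{1..<n}. c i dvd c (i + 1) \<and> c i \<noteq> c (i + 1))"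

text \<open>An element that survives one more round is not minimal in the previous layer, so it has
  a proper divisor there. Descending through m rounds gives m + 1 elements.\<close>

lemma dvd_chain_peel:
  assumes "b \<in> peel S m"
  shows "\<exists>c. dvd_chain S (Suc m) c \<and> c (Suc m) = b"
  using assms
proof (induction m arbitrary: b)
  case 0
  then show ?case by (intro exI[of _ "\<lambda>_. b"]) (auto simp: dvd_chain_def)
next
  case (Suc m)
  then obtain b' where b': "b' \<in> peel S m" "b' dvd b" "b' \<noteq> b" by (auto simp: minimal_part_def)
  obtain c where c: "dvd_chain S (Suc m) c" "c (Suc m) = b'" using Suc.IH[OF b'(1)] by blast
  have "b \<in> S" using Suc.prems peel_subset[of S "Suc m"] by blast
  then have "dvd_chain S (Suc (Suc m)) (c(Suc (Suc m) := b))"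
    using c b' by (auto simp: dvd_chain_def less_Suc_eq image_subset_iff le_Suc_eq)
  then show ?case by (metis fun_upd_same)
qed

lemma dvd_chain_inj_on:
  assumes "dvd_chain S n c" "S \<subseteq> {2..}"
  shows "inj_on c {1..n}"
proof -
  have step: "c i < c (Suc i)" if "1 \<le> i" "Suc i \<le> n" for i
  proof -
    have "c i dvd c (Suc i)" "c i \<noteq> c (Suc i)" "c (Suc i) \<in> S"
      using assms(1) that by (auto simp: dvd_chain_def)
    moreover from this(3) have "c (Suc i) > 0" using assms(2) by auto
    ultimately show ?thesis by (simp add: dvd_imp_le le_neq_implies_less)
  qed
  have mono: "1 \<le> i \<Longrightarrow> i < j \<Longrightarrow> j \<le> n \<Longrightarrow> c i < c j" for i j
  proof (induction j)
    case (Suc j)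
    then show ?case using step[of j] by (cases "i = j") (auto intro: less_trans)
  qed simp
  show ?thesis
  proof (rule inj_onI)
    fix i j assume "i \<in> {1..n}" "j \<in> {1..n}" "c i = c j"
    then show "i = j" using mono[of i j] mono[of j i] by (cases i j rule: linorder_cases) auto
  qed
qed

text \<open>Without a chain of length n, the set B - F is exhausted after n - 1 rounds of peeling.
  Then \<open>f_sum z B\<close> is at most (n - 1) * exp (18 * z) plus the contribution of the
  finite set B \<inter> F, and in the limit only n - 1 remains.\<close>

lemma exists_dvd_chain_avoiding:
  assumes B: "B \<subseteq> {2..}" and n: "n \<ge> 1" and eta: "upper_eta B > ennreal (real n - 1)" and F: "finite F"
  shows "\<exists>c. dvd_chain (B - F) n c"
proof (rule ccontr)
  assume no: "\<not> ?thesis"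
  define m where "m = n - 1"
  have m: "n = Suc m" using n by (simp add: m_def)
  have empty: "peel (B - F) m = {}"
    using dvd_chain_peel[of _ "B - F" m] no m by blast
  have F2: "((\<lambda>z. f_sum z (B \<inter> F)) \<longlongrightarrow> 0) (at_right 0)"
    using F B by (intro f_sum_finite_tendsto_0) auto
  have "((\<lambda>z. of_nat m * ennreal (exp (18 * z)) + f_sum z (B \<inter> F)) \<longlongrightarrow> of_nat m * 1 + 0) (at_right 0)"
    by (intro tendsto_add F2 tendsto_mult_ennreal tendsto_const tendsto_ennreal_exp) auto
  then have "Limsup (at_right 0) (\<lambda>z. of_nat m * ennreal (exp (18 * z)) + f_sum z (B \<inter> F)) = of_nat m"
    by (intro lim_imp_Limsup) auto
  moreover have "Limsup (at_right 0) (\<lambda>z. f_sum z B) \<le>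
      Limsup (at_right 0) (\<lambda>z. of_nat m * ennreal (exp (18 * z)) + f_sum z (B \<inter> F))"
  proof (rule Limsup_mono)
    show "\<forall>\<^sub>F z in at_right 0. f_sum z B \<le> of_nat m * ennreal (exp (18 * z)) + f_sum z (B \<inter> F)"
      using eventually_at_right_0_le_1
    proof eventually_elim
      case (elim z)
      have "f_sum z B = f_sum z ((B - F) \<union> (B \<inter> F))" by (rule arg_cong[where f = "f_sum z"]) blast
      also have "\<dots> \<le> f_sum z (B - F) + f_sum z (B \<inter> F)" by (rule f_sum_Un_le)
      also have "f_sum z (B - F) \<le> of_nat m * ennreal (exp (18 * z)) + f_sum z (peel (B - F) m)"
        using B elim by (intro f_sum_le_peel) auto
      also have "f_sum z (peel (B - F) m) = 0" unfolding empty by (simp add: f_sum_def)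
      finally show ?case by (simp add: add_right_mono)
    qed
  qed
  ultimately have "upper_eta B \<le> of_nat m" using B by (auto simp: upper_eta_def)
  also have "of_nat m = ennreal (real n - 1)" using m by (simp add: ennreal_of_nat_eq_real_of_nat)
  finally show False using eta by simp
qed

lemma exists_disjoint_dvd_chains:
  assumes B: "B \<subseteq> {2..}" and n: "n \<ge> 1" and eta: "upper_eta B > ennreal (real n - 1)"
  shows "\<exists>b :: nat \<Rightarrow> nat \<Rightarrow> nat. inj_on (\<lambda>(j, i). b j i) (UNIV \<times> {1..n}) \<and>
    (\<forall>j. \<forall>i\<in>{1..n}. b j i \<in> B) \<and> (\<forall>j. \<forall>i\<in>{1..<n}. b j i dvd b j (i + 1))"
proof -
  \<comment> \<open>Chains are chosen one after the other. Each avoids the finitely many entries of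
    all earlier ones, which costs no upper density.\<close>
  define P where "P = (\<lambda>(b :: nat \<Rightarrow> nat \<Rightarrow> nat) j c. dvd_chain (B - (\<Union>i<j. b i ` {1..n})) n c)"
  have "\<exists>b. \<forall>j. P b j (b j)"
  proof (rule dependent_wellorder_choice)
    show "P f j c = P g j c" if "\<And>i. i < j \<Longrightarrow> f i = g i" for c f g j
      using that by (simp add: P_def)
    show "\<exists>c. P f j c" for j f
      unfolding P_def by (intro exists_dvd_chain_avoiding[OF B n eta]) auto
  qed
  then obtain b where "\<forall>j. P b j (b j)" by blast
  then have b: "dvd_chain (B - (\<Union>i<j. b i ` {1..n})) n (b j)" for j unfolding P_def by blast
  have new: "b j i \<noteq> b j' i'" if "j' < j" "i \<in> {1..n}" "i' \<in> {1..n}" for i i' j j'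
  proof -
    have "b j i \<notin> (\<Union>i<j. b i ` {1..n})" using b[of j] that(2) unfolding dvd_chain_def by blast
    moreover have "b j' i' \<in> (\<Union>i<j. b i ` {1..n})" using that(1,3) by blast
    ultimately show ?thesis by metis
  qed
  have inj: "inj_on (b j) {1..n}" for j
    using B by (intro dvd_chain_inj_on[OF b]) auto
  have "inj_on (\<lambda>(j, i). b j i) (UNIV \<times> {1..n})"
  proof (rule inj_onI, clarify)
    fix j i j' i' assume i: "i \<in> {1..n}" "i' \<in> {1..n}" and eq: "b j i = b j' i'"
    have "j = j'" using new[of j' j i i'] new[of j j' i' i] i eq by (cases j j' rule: linorder_cases) auto
    with inj[of j] i eq show "j = j' \<and> i = i'" by (auto dest: inj_onD)
  qed
  moreover have "\<forall>j. \<forall>i\<in>{1..n}. b j i \<in> B" using b by (auto simp: dvd_chain_def image_subset_iff)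
  moreover have "\<forall>j. \<forall>i\<in>{1..<n}. b j i dvd b j (i + 1)" using b by (auto simp: dvd_chain_def)
  ultimately show ?thesis by blast
qed

section \<open>Infinite density without infinite chains\<close>

lemma prime_Omega_strict_mono:
  assumes "a dvd b" "a \<noteq> b" "b > 0"
  shows "prime_Omega a < prime_Omega b"
proof -
  obtain m where m: "b = a * m" using assms by blast
  then have pos: "a > 0" "m > 0" using assms by auto
  have "m \<noteq> 1" using m assms by auto
  then have "prime_Omega m \<noteq> 0" using prime_Omega_eq_0_iff[of m] pos by auto
  then show ?thesis using m pos by (simp add: prime_Omega_mult)
qed

lemma exists_infinite_density_without_infinite_chain:
  "\<exists>B::nat set. B \<subseteq> {2..} \<and> has_primitive_density B \<infinity> \<and>
      \<not> (\<exists>b :: nat \<Rightarrow> nat. inj b \<and> (\<forall>i. b i \<in> B) \<and> (\<forall>i. b i dvd b (Suc i)))"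
proof -
  \<comment> \<open>Every prime factor limits the number of prime factors. A prime dividing the
    first term of a chain divides all later terms and so bounds their \<open>prime_Omega\<close>,
    which nevertheless grows at each step.\<close>
  define B where "B = {n. n \<ge> 2 \<and> (\<forall>p\<in>prime_factors n. prime_Omega n \<le> p)}"
  have nochain: False if b: "inj b" "\<And>i. b i \<in> B" "\<And>i. b i dvd b (Suc i)" for b :: "nat \<Rightarrow> nat"
  proof -
    have b2: "b i \<ge> 2" for i using b(2)[of i] by (simp add: B_def)
    then obtain p where p: "prime p" "p dvd b 0"
      using prime_factor_nat[of "b 0"] by (metis numeral_le_one_iff semiring_norm(69))
    have pd: "p dvd b i" for i by (induction i) (use p b(3) dvd_trans in auto)
    have "prime_Omega (b i) \<ge> i" for i
    proof (induction i)
      case (Suc i)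
      have "b i \<noteq> b (Suc i)" using b(1) by (metis injD n_not_Suc_n)
      then have "prime_Omega (b i) < prime_Omega (b (Suc i))"
        using b(3) b2[of "Suc i"] by (intro prime_Omega_strict_mono) auto
      with Suc show ?case by simp
    qed simp
    moreover have "prime_Omega (b (Suc p)) \<le> p"
    proof -
      have "p \<in> prime_factors (b (Suc p))"
        using p pd[of "Suc p"] b2[of "Suc p"] by (intro prime_factorsI) auto
      then show ?thesis using b(2)[of "Suc p"] by (simp add: B_def)
    qed
    ultimately show False by (metis not_less_eq_eq order_trans)
  qed
  define Q where "Q = (\<lambda>k::nat. {p. prime p \<and> k \<le> p})"
  \<comment> \<open>The pieces are disjoint because \<open>prime_Omega\<close> takes the value k on
    S k, and each has density 1 because only the finitely many primes below k are excluded.\<close>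
  define S where "S = (\<lambda>k. smooth_almost_primes (Q k) k)"
  have S1: "((\<lambda>z. f_sum z (S k)) \<longlongrightarrow> 1) (at_right 0)" if "k \<ge> 1" for k
    unfolding S_def
  proof (rule f_sum_smooth_almost_primes_tendsto[OF _ _ that])
    have "{p. prime p} - Q k \<subseteq> {..<k}" by (auto simp: Q_def)
    then show "finite ({p. prime p} - Q k)" by (rule finite_subset) simp
  qed (auto simp: Q_def)
  have SB: "S k \<subseteq> B" if "k \<ge> 1" for k
  proof
    fix n assume n: "n \<in> S k"
    then have "n \<in> almost_primes k"
      by (auto simp: S_def smooth_almost_primes_def smooth_numbers_def almost_primes_def)
    then have "n \<ge> 2" using almost_primes_subset[OF that] by auto
    then show "n \<in> B" using n
      by (auto simp: B_def S_def smooth_almost_primes_def smooth_numbers_def Q_def)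
  qed
  have lower: "(\<Sum>k=1..K. f_sum z (S k)) \<le> f_sum z B" for K z
  proof -
    have "(\<Sum>k=1..K. f_sum z (S k)) = f_sum z (\<Union>k\<in>{1..K}. S k)"
      unfolding f_sum_def
      by (rule sum_infsum) (auto simp: S_def smooth_almost_primes_def)
    also have "\<dots> \<le> f_sum z B" using SB by (intro f_sum_mono UN_least) simp
    finally show ?thesis .
  qed
  have "((\<lambda>z. f_sum z B) \<longlongrightarrow> \<infinity>) (at_right 0)"
  proof (rule order_tendstoI)
    fix a :: ennreal assume "a < \<infinity>"
    then obtain K where K: "a < of_nat K" using ennreal_Ex_less_of_nat[of a] by auto
    have "((\<lambda>z. \<Sum>k=1..K. f_sum z (S k)) \<longlongrightarrow> (\<Sum>k=1..K. 1)) (at_right 0)"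
      by (intro tendsto_sum S1) auto
    then have "\<forall>\<^sub>F z in at_right 0. a < (\<Sum>k=1..K. f_sum z (S k))"
      by (rule order_tendstoD) (use K in simp)
    then show "\<forall>\<^sub>F z in at_right 0. a < f_sum z B"
      by eventually_elim (use lower less_le_trans in blast)
  qed simp
  moreover have "B \<subseteq> {2..}" by (auto simp: B_def)
  moreover from this have "B \<noteq> {1}" by auto
  ultimately show ?thesis
    using has_primitive_density_of_tendsto[of B \<infinity>] nochain by (intro exI[of _ B]) blast
qed

section \<open>A primitive set without a density\<close>

lemma f_sum_primes_tendsto: "((\<lambda>z. f_sum z {p. prime p}) \<longlongrightarrow> 1) (at_right 0)"
  using f_sum_smooth_almost_primes_tendsto[of "{p. prime p}" 1] smooth_almost_primes_1[of "{p. prime p}"]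
  by simp

text \<open>First z is taken so small that the primes up to N carry less than e and all primes
  together a mass within e of 1. For this fixed z a finite set of primes already carries more than 1
  - e, and N' is chosen beyond it.\<close>

lemma f_sum_primes_window:
  fixes e :: real
  assumes e: "0 < e" "e < 1"
  shows "\<exists>z N'. 0 < z \<and> z < e \<and> N < N' \<and> f_sum z {p. prime p \<and> p \<le> N} < ennreal e \<and>
    f_sum z {p. prime p \<and> N' < p} < ennreal (2 * e) \<and>
    ennreal (1 - e) \<le> ennreal e + f_sum z {p. prime p \<and> N < p \<and> p \<le> N'}"
proof -
  let ?P = "{p::nat. prime p}"
  have "\<forall>\<^sub>F z in at_right 0. f_sum z {p. prime p \<and> p \<le> N} < ennreal e"
  proof (rule order_tendstoD(2)[OF f_sum_finite_tendsto_0])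
    show "finite {p. prime p \<and> p \<le> N}" by (rule finite_subset[of _ "{..N}"]) auto
    show "{p. prime p \<and> p \<le> N} \<subseteq> {2..}" using prime_ge_2_nat by auto
  qed (use e in simp)
  moreover have "\<forall>\<^sub>F z in at_right 0. ennreal (1 - e) < f_sum z ?P"
    using e by (intro order_tendstoD(1)[OF f_sum_primes_tendsto]) (simp add: ennreal_less_one_iff)
  moreover have "\<forall>\<^sub>F z in at_right 0. f_sum z ?P < ennreal (1 + e)"
    using e by (intro order_tendstoD(2)[OF f_sum_primes_tendsto]) (simp add: ennreal_1[symmetric] ennreal_less_iff del: ennreal_1)
  moreover have "\<forall>\<^sub>F z::real in at_right 0. 0 < z \<and> z < e"
    using e unfolding eventually_at_right_field by (intro exI[of _ e]) auto
  ultimately have "\<forall>\<^sub>F z::real in at_right 0. 0 < z \<and> z < e \<and> f_sum z {p. prime p \<and> p \<le> N} < ennreal e \<and>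
      ennreal (1 - e) < f_sum z ?P \<and> f_sum z ?P < ennreal (1 + e)"
    by eventually_elim auto
  then obtain z where z: "0 < z" "z < e" "f_sum z {p. prime p \<and> p \<le> N} < ennreal e"
      "ennreal (1 - e) < f_sum z ?P" "f_sum z ?P < ennreal (1 + e)"
    using eventually_happens'[OF trivial_limit_at_right_real] by blast
  obtain F where F: "finite F" "F \<subseteq> ?P" "ennreal (1 - e) < f_sum z F"
  proof -
    let ?g = "\<lambda>a. ennreal (z ^ prime_Omega a / (real a * ln (real a) powr z))"
    have "f_sum z ?P = (SUP F\<in>{F. finite F \<and> F \<subseteq> ?P}. sum ?g F)"
      unfolding f_sum_def by (rule nonneg_infsum_complete) simp
    then obtain F where F: "finite F" "F \<subseteq> ?P" "ennreal (1 - e) < sum ?g F"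
      using z(4) by (auto simp only: less_SUP_iff mem_Collect_eq)
    moreover have "sum ?g F = f_sum z F" using F(1) by (simp add: f_sum_def)
    ultimately show ?thesis using that by metis
  qed
  define N' where "N' = Suc (Max (insert N F))"
  have le: "a \<le> Max (insert N F)" if "a \<in> insert N F" for a
    using F(1) that by (intro Max_ge) auto
  have N': "N < N'" using le[of N] by (simp only: N'_def less_Suc_eq_le insertI1)
  have FN: "a \<le> N'" if "a \<in> F" for a
    using le[of a] that by (simp only: N'_def le_SucI insertI2)
  let ?L = "{p. prime p \<and> p \<le> N'}" and ?H = "{p. prime p \<and> N' < p}"
  have L: "ennreal (1 - e) \<le> f_sum z ?L"
  proof -
    have "F \<subseteq> ?L" using F(2) FN by blast
    from less_imp_le[OF F(3)] f_sum_mono[OF this] show ?thesis by (rule order_trans)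
  qed
  \<comment> \<open>The total is below 1 + e and at least 1 - e of it lies on primes up to
    N'.\<close>
  have "f_sum z ?H < ennreal (2 * e)"
  proof (rule ccontr)
    assume "\<not> ?thesis"
    then have "ennreal (1 - e) + ennreal (2 * e) \<le> f_sum z ?L + f_sum z ?H"
      using L by (intro add_mono) auto
    also have "\<dots> = f_sum z (?L \<union> ?H)"
      unfolding f_sum_def by (rule infsum_Un_disjoint[symmetric]) auto
    also have "?L \<union> ?H = ?P" by auto
    also have "f_sum z ?P < ennreal (1 + e)" by (rule z(5))
    finally show False using e by (simp add: ennreal_plus[symmetric] add.commute del: ennreal_plus)
  qed
  moreover have "ennreal (1 - e) \<le> ennreal e + f_sum z {p. prime p \<and> N < p \<and> p \<le> N'}"
  proof -
    note L
    also have "?L = {p. prime p \<and> p \<le> N} \<union> {p. prime p \<and> N < p \<and> p \<le> N'}" using N' by auto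
    also have "f_sum z \<dots> \<le> f_sum z {p. prime p \<and> p \<le> N} + f_sum z {p. prime p \<and> N < p \<and> p \<le> N'}"
      by (rule f_sum_Un_le)
    also have "\<dots> \<le> ennreal e + f_sum z {p. prime p \<and> N < p \<and> p \<le> N'}"
      using z(3) by (intro add_right_mono) simp
    finally show ?thesis .
  qed
  ultimately show ?thesis using z N' by blast
qed

lemma primitive_set_primes:
  assumes "A \<subseteq> {p. prime p}"
  shows "primitive_set A"
  unfolding primitive_set_def
proof (intro conjI ballI impI)
  show "A \<subseteq> {1..}" using assms by (auto dest!: subsetD prime_ge_1_nat)
  fix a b assume "a \<in> A" "b \<in> A" "a dvd b"
  then show "a = b" using assms primes_dvd_imp_eq by blast
qed

text \<open>A gliding hump: the primes in every other window \<open>(N j, N (j + 1)]\<close>, where \<open>f_sum (z j)\<close>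
  gives almost all its mass to the \<open>j\<close>-th window.\<close>

lemma exists_primitive_oscillating:
  "\<exists>A. primitive_set A \<and> lower_eta A = 0 \<and> upper_eta A = 1"
proof -
  define e where "e = (\<lambda>j::nat. 1 / (real j + 3))"
  have e: "0 < e j" "e j < 1" for j by (simp_all add: e_def)
  have elim: "e \<longlonglongrightarrow> 0"
    using LIMSEQ_ignore_initial_segment[OF lim_1_over_n, of 3] by (simp add: e_def add.commute)
  \<comment> \<open>A state pairs the end of a window with the parameter z that was chosen together
    with that end. This is why \<open>z j\<close> is read from \<open>f (Suc j)\<close>: it belongs
    to the window from \<open>N j\<close> to \<open>N (Suc j)\<close>.\<close>
  let ?R = "\<lambda>j x y. 0 < snd y \<and> snd y < e j \<and> fst x < fst y \<and> f_sum (snd y) {p. prime p \<and> p \<le> fst x} < ennreal (e j) \<and>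
    f_sum (snd y) {p. prime p \<and> fst y < p} < ennreal (2 * e j) \<and>
    ennreal (1 - e j) \<le> ennreal (e j) + f_sum (snd y) {p. prime p \<and> fst x < p \<and> p \<le> fst y}"
  have "\<exists>f :: nat \<Rightarrow> nat \<times> real. \<forall>j. True \<and> ?R j (f j) (f (Suc j))"
  proof (rule dependent_nat_choice)
    fix x :: "nat \<times> real" and j
    show "\<exists>y. True \<and> ?R j x y"
      using f_sum_primes_window[OF e[of j], of "fst x"] by auto
  qed simp
  then obtain f :: "nat \<Rightarrow> nat \<times> real" where f: "\<And>j. ?R j (f j) (f (Suc j))" by blast
  define N where "N = (\<lambda>j. fst (f j))"
  define z where "z = (\<lambda>j. snd (f (Suc j)))"
  have z: "0 < z j" "z j < e j" for j using f[of j] by (auto simp: z_def)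
  have Nlt: "N j < N (Suc j)" for j using f[of j] by (simp add: N_def)
  have Nmono: "N i \<le> N j" if "i \<le> j" for i j using lift_Suc_mono_le[of N i j] Nlt that by (simp add: less_imp_le)
  have low: "f_sum (z j) {p. prime p \<and> p \<le> N j} < ennreal (e j)"
    and high: "f_sum (z j) {p. prime p \<and> N (Suc j) < p} < ennreal (2 * e j)"
    and mid: "ennreal (1 - e j) \<le> ennreal (e j) + f_sum (z j) {p. prime p \<and> N j < p \<and> p \<le> N (Suc j)}" for j
    using f[of j] by (auto simp: z_def N_def)
  define A where "A = {p. prime p \<and> (\<exists>i. N (2 * i) < p \<and> p \<le> N (Suc (2 * i)))}"
  have AP: "A \<subseteq> {p. prime p}" by (auto simp: A_def)
  have prim: "primitive_set A" by (rule primitive_set_primes[OF AP])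
  have A1: "A \<noteq> {1}" using AP by auto
  \<comment> \<open>The parameters z j are positive and tend to 0, so a property that holds near 0
    on the right eventually holds along them; limsup and liminf can be tested on
    subsequences.\<close>
  have ev: "\<forall>\<^sub>F j in sequentially. P (z j)" if P: "eventually P (at_right 0)" for P
  proof -
    obtain b where b: "b > 0" "\<And>x. 0 < x \<Longrightarrow> x < b \<Longrightarrow> P x"
      using P unfolding eventually_at_right_field by auto
    have "\<forall>\<^sub>F j in sequentially. e j < b" using order_tendstoD(2)[OF elim b(1)] .
    then show ?thesis by eventually_elim (use b(2) z less_trans in blast)
  qed
  have sub0: "filterlim (\<lambda>i. 2 * i) sequentially sequentially" and sub1: "filterlim (\<lambda>i. Suc (2 * i)) sequentially sequentially"
    by (rule filterlim_subseq, simp add: strict_mono_def)+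
  have even: "ennreal (1 - 2 * e (2 * i)) \<le> f_sum (z (2 * i)) A" for i
  proof -
    let ?x = "f_sum (z (2 * i)) A"
    have "ennreal (1 - e (2 * i)) \<le> ennreal (e (2 * i)) + f_sum (z (2 * i)) {p. prime p \<and> N (2 * i) < p \<and> p \<le> N (Suc (2 * i))}"
      by (rule mid)
    also have "\<dots> \<le> ennreal (e (2 * i)) + ?x"
      by (intro add_left_mono f_sum_mono) (auto simp: A_def)
    finally have x: "ennreal (1 - e (2 * i)) \<le> ennreal (e (2 * i)) + ?x" .
    show ?thesis
    proof (cases ?x)
      case (real r)
      then have "1 - e (2 * i) \<le> e (2 * i) + r"
        using x e[of "2 * i"] by (simp add: ennreal_plus[symmetric] ennreal_le_iff del: ennreal_plus)
      then show ?thesis using real by (simp add: ennreal_leI)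
    qed simp
  qed
  have odd: "f_sum (z (Suc (2 * i))) A \<le> ennreal (3 * e (Suc (2 * i)))" for i
  proof -
    \<comment> \<open>A skips the windows of odd index, so at z ?j it only has the mass before and
      after that window, at most e + 2e.\<close>
    let ?j = "Suc (2 * i)"
    have "A \<subseteq> {p. prime p \<and> p \<le> N ?j} \<union> {p. prime p \<and> N (Suc ?j) < p}"
    proof
      fix p assume "p \<in> A"
      then obtain i' where p: "prime p" "N (2 * i') < p" "p \<le> N (Suc (2 * i'))" by (auto simp: A_def)
      show "p \<in> {p. prime p \<and> p \<le> N ?j} \<union> {p. prime p \<and> N (Suc ?j) < p}"
      proof (cases "i' \<le> i")
        case True
        then show ?thesis using p Nmono[of "Suc (2 * i')" ?j] by auto
      next
        case False
        then show ?thesis using p Nmono[of "Suc ?j" "2 * i'"] by auto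
      qed
    qed
    then have "f_sum (z ?j) A \<le> f_sum (z ?j) ({p. prime p \<and> p \<le> N ?j} \<union> {p. prime p \<and> N (Suc ?j) < p})"
      by (rule f_sum_mono)
    also have "\<dots> \<le> f_sum (z ?j) {p. prime p \<and> p \<le> N ?j} + f_sum (z ?j) {p. prime p \<and> N (Suc ?j) < p}"
      by (rule f_sum_Un_le)
    also have "\<dots> \<le> ennreal (e ?j) + ennreal (2 * e ?j)"
      using low[of ?j] high[of ?j] by (intro add_mono less_imp_le)
    also have "\<dots> = ennreal (3 * e ?j)" using e[of ?j] by (simp add: ennreal_plus[symmetric] del: ennreal_plus)
    finally show ?thesis .
  qed
  have "1 \<le> Limsup (at_right 0) (\<lambda>z. f_sum z A)"
  proof (rule Limsup_greatest)
    fix P assume "eventually P (at_right (0::real))"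
    from eventually_compose_filterlim[OF ev[OF this] sub0]
    have P: "\<forall>\<^sub>F i in sequentially. P (z (2 * i))" .
    have "((\<lambda>i. 1 - 2 * e (2 * i)) \<longlonglongrightarrow> 1 - 2 * 0)"
      by (intro tendsto_intros filterlim_compose[OF elim sub0])
    from tendsto_ennrealI[OF this] have "(\<lambda>i. ennreal (1 - 2 * e (2 * i))) \<longlonglongrightarrow> 1" by simp
    then show "1 \<le> (SUP x\<in>Collect P. f_sum x A)"
    proof (rule tendsto_upperbound)
      show "\<forall>\<^sub>F i in sequentially. ennreal (1 - 2 * e (2 * i)) \<le> (SUP x\<in>Collect P. f_sum x A)"
        using P by eventually_elim (auto intro!: SUP_upper2 even)
    qed simp
  qed
  then have "upper_eta A = 1" using upper_eta_primitive_le_1[OF prim] A1 by (simp add: upper_eta_def)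
  moreover have "Liminf (at_right 0) (\<lambda>z. f_sum z A) \<le> 0"
  proof (rule Liminf_least)
    fix P assume "eventually P (at_right (0::real))"
    from eventually_compose_filterlim[OF ev[OF this] sub1]
    have P: "\<forall>\<^sub>F i in sequentially. P (z (Suc (2 * i)))" .
    have "((\<lambda>i. 3 * e (Suc (2 * i))) \<longlonglongrightarrow> 3 * 0)"
      by (intro tendsto_intros filterlim_compose[OF elim sub1])
    from tendsto_ennrealI[OF this] have "(\<lambda>i. ennreal (3 * e (Suc (2 * i)))) \<longlonglongrightarrow> 0" by simp
    then show "(INF x\<in>Collect P. f_sum x A) \<le> 0"
    proof (rule tendsto_lowerbound)
      show "\<forall>\<^sub>F i in sequentially. (INF x\<in>Collect P. f_sum x A) \<le> ennreal (3 * e (Suc (2 * i)))"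
        using P by eventually_elim (auto intro!: INF_lower2 odd)
    qed simp
  qed
  then have "lower_eta A = 0" using A1 by (simp add: lower_eta_def)
  ultimately show ?thesis using prim by blast
qed

theorem theorem6:
  "(\<forall>A. primitive_set A \<longrightarrow>
      0 \<le> lower_eta A \<and> lower_eta A \<le> upper_eta A \<and> upper_eta A \<le> 1) \<and>
   (\<forall>k. has_primitive_density (almost_primes k) 1) \<and>
   (\<exists>A. primitive_set A \<and> lower_eta A = 0 \<and> upper_eta A = 1) \<and>
   (\<forall>(k::nat) (A::nat set) (c::real).
      A \<subseteq> almost_primes k \<longrightarrow>
      ((\<lambda>s. (\<Sum>\<^sub>\<infinity>a\<in>A. real a powr (- s)) /
             (\<Sum>\<^sub>\<infinity>m\<in>almost_primes k. real m powr (- s))) \<longlongrightarrow> c) (at_right 1) \<longrightarrow>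
      has_primitive_density A (ennreal c)) \<and>
   (\<forall>(B::nat set) (n::nat).
      B \<subseteq> {2..} \<longrightarrow> n \<ge> 1 \<longrightarrow> upper_eta B > ennreal (real n - 1) \<longrightarrow>
      (\<exists>b :: nat \<Rightarrow> nat \<Rightarrow> nat.
         inj_on (\<lambda>(j, i). b j i) (UNIV \<times> {1..n}) \<and>
         (\<forall>j. \<forall>i\<in>{1..n}. b j i \<in> B) \<and>
         (\<forall>j. \<forall>i\<in>{1..<n}. b j i dvd b j (i + 1)))) \<and>
   (\<exists>B::nat set. B \<subseteq> {2..} \<and> has_primitive_density B \<infinity> \<and>
      \<not> (\<exists>b :: nat \<Rightarrow> nat. inj b \<and> (\<forall>i. b i \<in> B) \<and> (\<forall>i. b i dvd b (Suc i))))"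
proof (intro conjI)
  show "\<forall>A. primitive_set A \<longrightarrow> 0 \<le> lower_eta A \<and> lower_eta A \<le> upper_eta A \<and> upper_eta A \<le> 1"
    using lower_eta_le_upper_eta upper_eta_primitive_le_1 by simp
  show "\<forall>k. has_primitive_density (almost_primes k) 1"
    using has_primitive_density_almost_primes by blast
  show "\<exists>A. primitive_set A \<and> lower_eta A = 0 \<and> upper_eta A = 1"
    by (rule exists_primitive_oscillating)
  show "\<forall>(k::nat) (A::nat set) (c::real).
      A \<subseteq> almost_primes k \<longrightarrow>
      ((\<lambda>s. (\<Sum>\<^sub>\<infinity>a\<in>A. real a powr (- s)) /
             (\<Sum>\<^sub>\<infinity>m\<in>almost_primes k. real m powr (- s))) \<longlongrightarrow> c) (at_right 1) \<longrightarrow>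
      has_primitive_density A (ennreal c)"
    using has_primitive_density_of_dirichlet_density by blast
  show "\<forall>(B::nat set) (n::nat).
      B \<subseteq> {2..} \<longrightarrow> n \<ge> 1 \<longrightarrow> upper_eta B > ennreal (real n - 1) \<longrightarrow>
      (\<exists>b :: nat \<Rightarrow> nat \<Rightarrow> nat.
         inj_on (\<lambda>(j, i). b j i) (UNIV \<times> {1..n}) \<and>
         (\<forall>j. \<forall>i\<in>{1..n}. b j i \<in> B) \<and>
         (\<forall>j. \<forall>i\<in>{1..<n}. b j i dvd b j (i + 1)))"
    using exists_disjoint_dvd_chains by simp
  show "\<exists>B::nat set. B \<subseteq> {2..} \<and> has_primitive_density B \<infinity> \<and>
      \<not> (\<exists>b :: nat \<Rightarrow> nat. inj b \<and> (\<forall>i. b i \<in> B) \<and> (\<forall>i. b i dvd b (Suc i)))"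
    by (rule exists_infinite_density_without_infinite_chain)
qed

end
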